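(* There exists a constant $c>0$ such that for every $n\ge2$, every convex body $K$ in $\mathbb{R}^n$ with centroid at $0$, and every $u,v\in S^{n-1}$ such that $v\neq\pm u$, one has $$\frac1c\le\frac{\big|\{x\in K:\langle x,u\rangle=0,\ \langle x,v\rangle\ge0\}\big|_{n-1}}{\big|\{x\in K:\langle x,u\rangle=0,\ \langle x,v\rangle\le0\}\big|_{n-1}}\le c.$$
   Context: A convex body is a compact convex set with nonempty interior; its centroid is $\frac{1}{|K|}\int_K x\,dx$. $|\cdot|_{n-1}$ denotes $(n-1)$-dimensional volume. *)

theory Defs
  imports "HOL-Analysis.Analysis"
begin

text \<open>
  The constant of the theorem does not depend on the dimension, so \<open>n\<close> has to be an ordinary
  natural number and cannot be a type. A point of \<open>\<real>\<^sup>n\<close> is a function in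
  \<open>{..<n} \<rightarrow>\<^sub>E UNIV\<close>, which is both the space of the \<open>n\<close>-fold product of \<^term>\<open>lborel\<close> and
  the carrier of the \<open>n\<close>-fold product topology.
\<close>

type_synonym point = "nat \<Rightarrow> real"

definition points :: "nat \<Rightarrow> point set" where
  "points n = ({..<n} \<rightarrow>\<^sub>E UNIV)"

definition origin :: "nat \<Rightarrow> point" where
  "origin n = (\<lambda>i\<in>{..<n}. 0)"

definition neg :: "nat \<Rightarrow> point \<Rightarrow> point" where
  "neg n x = (\<lambda>i\<in>{..<n}. - x i)"

definition inner_prod :: "nat \<Rightarrow> point \<Rightarrow> point \<Rightarrow> real" where
  "inner_prod n x y = (\<Sum>i<n. x i * y i)"

definition unit_sphere :: "nat \<Rightarrow> point set" where
  "unit_sphere n = {x \<in> points n. inner_prod n x x = 1}"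

definition topology_on_points :: "nat \<Rightarrow> point topology" where
  "topology_on_points n = product_topology (\<lambda>_. euclideanreal) {..<n}"

definition lebesgue_on_points :: "nat \<Rightarrow> point measure" where
  "lebesgue_on_points n = PiM {..<n} (\<lambda>_. lborel)"

definition convex_set :: "nat \<Rightarrow> point set \<Rightarrow> bool" where
  "convex_set n K \<longleftrightarrow> K \<subseteq> points n \<and>
     (\<forall>x\<in>K. \<forall>y\<in>K. \<forall>s\<ge>0. \<forall>t\<ge>0. s + t = 1 \<longrightarrow> (\<lambda>i\<in>{..<n}. s * x i + t * y i) \<in> K)"

definition convex_body :: "nat \<Rightarrow> point set \<Rightarrow> bool" where
  "convex_body n K \<longleftrightarrow> convex_set n K \<and> compactin (topology_on_points n) K \<and>
     topology_on_points n interior_of K \<noteq> {}"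

definition centroid :: "nat \<Rightarrow> point set \<Rightarrow> point" where
  "centroid n K = (\<lambda>i\<in>{..<n}.
     1 / measure (lebesgue_on_points n) K * (LINT x:K|lebesgue_on_points n. x i))"

text \<open>
  Since the orthogonal complement of a unit vector \<open>u\<close> has dimension \<open>n - 1\<close>, any \<open>n - 1\<close>
  orthonormal vectors orthogonal to \<open>u\<close> form an orthonormal basis of it.
\<close>

definition hyperplane_basis :: "nat \<Rightarrow> point \<Rightarrow> (nat \<Rightarrow> point) \<Rightarrow> bool" where
  "hyperplane_basis n u b \<longleftrightarrow>
     (\<forall>j<n - 1. b j \<in> points n \<and> inner_prod n (b j) u = 0 \<and>
        (\<forall>k<n - 1. inner_prod n (b j) (b k) = (if j = k then 1 else 0)))"

text \<open>
  The \<open>(n - 1)\<close>-dimensional volume of a subset \<open>A\<close> of the hyperplane orthogonal to \<open>u\<close> is the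
  Lebesgue measure of \<open>A\<close> in coordinates with respect to an orthonormal basis of this
  hyperplane. It does not depend on the basis, because Lebesgue measure is invariant under
  orthogonal maps.
\<close>

definition hyperplane_volume :: "nat \<Rightarrow> point \<Rightarrow> point set \<Rightarrow> real" where
  "hyperplane_volume n u A =
     (let b = (SOME b. hyperplane_basis n u b)
      in measure (lebesgue_on_points (n - 1))
           {t \<in> points (n - 1). (\<lambda>i\<in>{..<n}. \<Sum>j<n - 1. t j * b j i) \<in> A})"

text \<open>The choice above is from a nonempty set: reflect the last standard basis vector to \<open>u\<close>.\<close>

lemma hyperplane_basis_exists:
  assumes u: "u \<in> unit_sphere n"
  shows "\<exists>b. hyperplane_basis n u b"
proof (cases n)
  case 0
  then show ?thesis by (simp add: hyperplane_basis_def)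
next
  case (Suc m)
  define e :: "nat \<Rightarrow> point" where "e j = (\<lambda>i. if i = j then 1 else 0)" for j
  define w where "w i = u i - e m i" for i
  define W where "W = inner_prod n w w"
  define a where "a j = 2 * w j / W" for j
  define b where "b j = (\<lambda>i\<in>{..<n}. e j i - a j * w i)" for j
  have uu: "inner_prod n u u = 1" using u by (simp add: unit_sphere_def)
  have ex: "(\<Sum>i<n. e j i * x i) = x j" if "j < n" for j and x :: point
  proof -
    have "(\<Sum>i<n. e j i * x i) = (\<Sum>i<n. if i = j then x i else 0)"
      by (rule sum.cong) (auto simp: e_def)
    then show ?thesis using that by simp
  qed
  have ee: "(\<Sum>i<n. e j i * e k i) = (if j = k then 1 else 0)" if "j < n" for j k
    using ex[OF that, of "e k"] by (simp add: e_def)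
  have m: "m < n" by (simp add: Suc)
  have wu: "(\<Sum>i<n. w i * u i) = 1 - u m"
    using uu ex[OF m, of u] by (simp add: w_def left_diff_distrib sum_subtractf inner_prod_def)
  have we: "(\<Sum>i<n. w i * e m i) = u m - 1"
    using ex[OF m, of w] by (simp add: mult.commute w_def e_def)
  have W: "W = 2 * (1 - u m)"
  proof -
    have "W = (\<Sum>i<n. w i * u i) - (\<Sum>i<n. w i * e m i)"
      unfolding W_def inner_prod_def sum_subtractf[symmetric]
      by (rule sum.cong) (simp_all add: w_def algebra_simps)
    then show ?thesis by (simp add: wu we)
  qed
  have w0: "w j = 0" if "W = 0" "j < n" for j
  proof -
    have "\<forall>i\<in>{..<n}. w i * w i = 0"
      using that(1) unfolding W_def inner_prod_def by (subst (asm) sum_nonneg_eq_0_iff) auto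
    then show ?thesis using that(2) by auto
  qed
  have aW: "a j * W = 2 * w j" if "j < n" for j
    using w0[of j] that by (cases "W = 0") (auto simp: a_def)
  have sym: "a j * w k = a k * w j" for j k by (simp add: a_def)
  have bu: "inner_prod n (b j) u = 0" if j: "j < m" for j
  proof -
    have jn: "j < n" using j Suc by simp
    have "inner_prod n (b j) u = (\<Sum>i<n. e j i * u i) - a j * (\<Sum>i<n. w i * u i)"
      unfolding inner_prod_def b_def sum_distrib_left sum_subtractf[symmetric]
      by (rule sum.cong) (simp_all add: algebra_simps)
    also have "\<dots> = u j - a j * W / 2" using ex[OF jn, of u] by (simp add: wu W)
    also have "\<dots> = 0" using j by (simp add: aW[OF jn] w_def e_def)
    finally show ?thesis .
  qed
  have bb: "inner_prod n (b j) (b k) = (if j = k then 1 else 0)" if j: "j < m" and k: "k < m" for j k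
  proof -
    have jn: "j < n" "k < n" using j k Suc by simp_all
    have "inner_prod n (b j) (b k) =
        (\<Sum>i<n. e j i * e k i) - a k * (\<Sum>i<n. e j i * w i) - a j * (\<Sum>i<n. e k i * w i)
        + a j * a k * W"
      unfolding inner_prod_def b_def W_def sum_distrib_left sum_subtractf[symmetric]
        sum.distrib[symmetric]
      by (rule sum.cong) (simp_all add: algebra_simps)
    also have "\<dots> = (if j = k then 1 else 0) - a k * w j - a j * w k + a k * (a j * W)"
      by (simp add: ee ex jn)
    also have "\<dots> = (if j = k then 1 else 0)"
      by (simp add: aW jn sym[of j k])
    finally show ?thesis .
  qed
  have "hyperplane_basis n u b"
    using bu bb by (auto simp: hyperplane_basis_def Suc points_def b_def)
  then show ?thesis by blast
qed

end

theory Submission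
  imports Defs
begin

text \<open>
  Only the projection of \<open>v\<close> to the hyperplane orthogonal to \<open>u\<close> matters for the two halves of the
  section, so let \<open>w\<close> be the unit vector in its direction. For real \<open>s\<close> and \<open>t\<close> let \<open>F (s, t)\<close> be the
  \<open>(n - 2)\<close>-dimensional volume of the set of those \<open>x \<in> K\<close> with \<open>\<langle>x, u\<rangle> = s\<close> and \<open>\<langle>x, w\<rangle> = t\<close>. By Fubini's theorem
  the two halves of the section have the volumes \<open>\<integral> F (0, t) dt\<close> over \<open>t \<ge> 0\<close> and over \<open>t \<le> 0\<close>, and the centroid of \<open>F\<close>
  is the origin. Convexity of \<open>K\<close> makes \<open>F\<close> log-concave, by the Prekopa--Leindler inequality
  (\<open>prekopa_leindler\<close>). The dimension has now disappeared: it remains to compare the integrals of a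
  planar log-concave function with centroid \<open>0\<close> over two opposite rays (\<open>ray_integrals\<close>), with an
  absolute constant.

  A log-concave function lives essentially on its core, the set where it is at least a fixed fraction of
  \<open>F 0\<close>. The integral over a ray is therefore comparable with \<open>F 0\<close> times the extent of the core along this ray,
  provided that \<open>F 0\<close> is comparable with the supremum of \<open>F\<close> (\<open>centroid_value\<close>). If the core reached much
  further in one direction than in the opposite one, a line would separate it from a point that is close
  to the origin on the short side; then the mass on the far side of the origin would dominate and pull the
  centroid away from \<open>0\<close> (\<open>core_symmetric\<close>). This is the argument by which the centroid of a
  planar convex set divides no chord through it too unevenly.

  All estimates of moments rest on one device (\<open>contraction\<close>). The map \<open>p \<mapsto> (p + z) / 2\<close> changes areas
  by the factor \<open>1/4\<close>, while log-concavity bounds \<open>F p\<close> by a multiple of \<open>F ((p + z) / 2)\<close>, with a small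
  constant where \<open>F p\<close> is small compared with \<open>F z\<close>. Hence the moments far out are dominated by
  the moments closer to \<open>z\<close>. Midpoints suffice throughout; convexity of the superlevel sets follows
  because these sets are closed, as \<open>K\<close> is compact.
\<close>

section \<open>The Prekopa--Leindler inequality at the midpoint\<close>

lemma emeasure_lborel_dilation:
  assumes [measurable]: "C \<in> sets borel"
  shows "emeasure lborel {x::real. x / 2 \<in> C} = 2 * emeasure lborel C"
proof -
  have "emeasure lborel {x::real. x / 2 \<in> C} = (\<integral>\<^sup>+x. indicator {x. x / 2 \<in> C} x \<partial>lborel)" by simp
  also have "\<dots> = 2 * (\<integral>\<^sup>+x. indicator {x. x / 2 \<in> C} (0 + 2 * x) \<partial>lborel)"
    by (subst nn_integral_real_affine[where c = 2 and t = 0]) auto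
  also have "(\<integral>\<^sup>+x. indicator {x. x / 2 \<in> C} (0 + 2 * x) \<partial>lborel) = (\<integral>\<^sup>+x. indicator C x \<partial>lborel)"
    by (intro nn_integral_cong) (auto simp: indicator_def)
  finally show ?thesis by simp
qed

lemma emeasure_lborel_translation:
  assumes [measurable]: "A \<in> sets borel"
  shows "emeasure lborel {x::real. x - b \<in> A} = emeasure lborel A"
proof -
  have "emeasure lborel {x::real. x - b \<in> A} = (\<integral>\<^sup>+x. indicator {x. x - b \<in> A} x \<partial>lborel)" by simp
  also have "\<dots> = (\<integral>\<^sup>+x. indicator {x. x - b \<in> A} (b + 1 * x) \<partial>lborel)"
    by (subst nn_integral_real_affine[where c = 1 and t = b]) auto
  also have "\<dots> = (\<integral>\<^sup>+x. indicator A x \<partial>lborel)"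
    by (intro nn_integral_cong) (auto simp: indicator_def)
  finally show ?thesis by simp
qed

text \<open>
  The one-dimensional Brunn--Minkowski inequality. If \<open>a\<close> is nearly the supremum of \<open>A\<close> and \<open>b\<close>
  nearly the infimum of \<open>B\<close>, then the translates \<open>A + b\<close> and \<open>a + B\<close> lie almost entirely on opposite
  sides of \<open>a + b\<close>, and both lie in the doubled set \<open>C\<close>.
\<close>
lemma brunn_minkowski_real_bounded:
  fixes A B C :: "real set"
  assumes [measurable]: "A \<in> sets borel" "B \<in> sets borel" "C \<in> sets borel"
    and ne: "A \<noteq> {}" "B \<noteq> {}" and bdd: "bdd_above A" "bdd_below B"
    and mid: "\<And>a b. a \<in> A \<Longrightarrow> b \<in> B \<Longrightarrow> (a + b) / 2 \<in> C"
  shows "emeasure lborel A + emeasure lborel B \<le> 2 * emeasure lborel C"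
proof (rule ennreal_le_epsilon)
  fix \<epsilon> :: real assume \<epsilon>: "0 < \<epsilon>"
  have "Sup A - \<epsilon> / 2 < Sup A" using \<epsilon> by simp
  then obtain a where a: "a \<in> A" "Sup A - \<epsilon> / 2 < a" unfolding less_cSup_iff[OF ne(1) bdd(1)] by blast
  have "Inf B < Inf B + \<epsilon> / 2" using \<epsilon> by simp
  then obtain b where b: "b \<in> B" "b < Inf B + \<epsilon> / 2" unfolding cInf_less_iff[OF ne(2) bdd(2)] by blast
  \<comment> \<open>The translates \<open>A + b\<close> and \<open>a + B\<close>; their overlap has length at most \<open>\<epsilon>\<close>.\<close>
  let ?P = "{x. x - b \<in> A}" and ?Q = "{x. x - a \<in> B}"
  have "emeasure lborel A + emeasure lborel B = emeasure lborel ?P + emeasure lborel ?Q"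
    by (simp add: emeasure_lborel_translation)
  also have "\<dots> = emeasure lborel (?P \<union> ?Q) + emeasure lborel (?P \<inter> ?Q)"
    by (rule emeasure_Un_Int) auto
  also have "emeasure lborel (?P \<union> ?Q) \<le> emeasure lborel {x. x / 2 \<in> C}"
    using mid[OF _ b(1)] mid[OF a(1)] by (intro emeasure_mono) (auto, fastforce+)
  also have "emeasure lborel (?P \<inter> ?Q) \<le> emeasure lborel {a + Inf B .. Sup A + b}"
    using cSup_upper[OF _ bdd(1)] cInf_lower[OF _ bdd(2)]
    by (intro emeasure_mono) (auto simp: algebra_simps, smt (verit), smt (verit))
  also have "\<dots> \<le> ennreal \<epsilon>"
    using a b \<epsilon> by (cases "a + Inf B \<le> Sup A + b") (auto intro!: ennreal_leI)
  finally show "emeasure lborel A + emeasure lborel B \<le> 2 * emeasure lborel C + ennreal \<epsilon>"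
    by (simp add: emeasure_lborel_dilation add_left_mono add_right_mono)
qed

lemma brunn_minkowski_real:
  fixes A B C :: "real set"
  assumes [measurable]: "A \<in> sets borel" "B \<in> sets borel" "C \<in> sets borel"
    and ne: "A \<noteq> {}" "B \<noteq> {}"
    and mid: "\<And>a b. a \<in> A \<Longrightarrow> b \<in> B \<Longrightarrow> (a + b) / 2 \<in> C"
  shows "emeasure lborel A + emeasure lborel B \<le> 2 * emeasure lborel C"
proof -
  obtain a b where ab: "a \<in> A" "b \<in> B" using ne by auto
  define A' where "A' k = A \<inter> {.. a + real k}" for k :: nat
  define B' where "B' k = B \<inter> {b - real k ..}" for k :: nat
  have [measurable]: "A' k \<in> sets borel" "B' k \<in> sets borel" for k unfolding A'_def B'_def by auto
  have inc: "incseq A'" "incseq B'" by (force simp: incseq_def A'_def B'_def)+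
  have A: "(\<Union>k. A' k) = A"
  proof -
    have "x \<in> (\<Union>k. A' k)" if "x \<in> A" for x
      using that real_arch_simple[of "x - a"] by (auto simp: A'_def algebra_simps)
    then show ?thesis by (auto simp: A'_def)
  qed
  have B: "(\<Union>k. B' k) = B"
  proof -
    have "x \<in> (\<Union>k. B' k)" if "x \<in> B" for x
      using that real_arch_simple[of "b - x"] by (auto simp: B'_def algebra_simps)
    then show ?thesis by (auto simp: B'_def)
  qed
  have "emeasure lborel A + emeasure lborel B = (SUP k. emeasure lborel (A' k)) + (SUP k. emeasure lborel (B' k))"
    using SUP_emeasure_incseq[of A' lborel] SUP_emeasure_incseq[of B' lborel] inc by (simp add: A B image_subset_iff)
  also have "\<dots> = (SUP k. emeasure lborel (A' k) + emeasure lborel (B' k))"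
    using inc by (intro ennreal_SUP_add[symmetric]) (auto simp: mono_def intro!: emeasure_mono, blast+)
  also have "\<dots> \<le> 2 * emeasure lborel C"
  proof (rule SUP_least)
    fix k
    have "a \<in> A' k" "b \<in> B' k" using ab by (auto simp: A'_def B'_def)
    then show "emeasure lborel (A' k) + emeasure lborel (B' k) \<le> 2 * emeasure lborel C"
      by (intro brunn_minkowski_real_bounded) (auto simp: A'_def B'_def mid intro!: bdd_above.I[of _ "a + real k"] bdd_below.I[of _ "b - real k"])
  qed
  finally show ?thesis .
qed

lemma ennreal_square_le_imp_le: "x * x \<le> y * y \<Longrightarrow> x \<le> y" for x y :: ennreal
proof (cases "y = top")
  case False
  assume le: "x * x \<le> y * y"
  then have "x \<noteq> top" using False by (auto simp: top_unique ennreal_mult_eq_top_iff)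
  then obtain r s where "x = ennreal r" "0 \<le> r" "y = ennreal s" "0 \<le> s"
    using False by (metis ennreal_cases)
  then show ?thesis using le by (auto simp flip: ennreal_mult intro: power2_le_imp_le simp: power2_eq_square)
qed simp

text \<open>
  Truncation at \<open>1\<close> keeps the levels in a bounded interval, on which the superlevel sets of two
  functions with supremum \<open>1\<close> are all nonempty.
\<close>
lemma layer_cake:
  fixes f :: "real \<Rightarrow> ennreal"
  assumes [measurable]: "f \<in> borel_measurable borel"
  shows "(\<integral>\<^sup>+x. min (f x) 1 \<partial>lborel)
    = (\<integral>\<^sup>+\<tau>. indicator {0..<1} \<tau> * emeasure lborel {x. ennreal \<tau> < f x} \<partial>lborel)"
proof -
  have "min (f x) 1 = (\<integral>\<^sup>+\<tau>. indicator {0..<1} \<tau> * indicator {x. ennreal \<tau> < f x} x \<partial>lborel)" for x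
  proof -
    obtain r where r: "min (f x) 1 = ennreal r" "0 \<le> r" "r \<le> 1"
      by (cases "min (f x) 1") (auto simp: top_unique min_def split: if_splits)
    have "(\<integral>\<^sup>+\<tau>. indicator {0..<1} \<tau> * indicator {x. ennreal \<tau> < f x} x \<partial>lborel) = (\<integral>\<^sup>+\<tau>. indicator {0..<r} \<tau> \<partial>lborel)"
    proof (intro nn_integral_cong)
      fix \<tau> :: real
      have "ennreal \<tau> < f x \<longleftrightarrow> \<tau> < r" if "0 \<le> \<tau>" "\<tau> < 1"
      proof -
        have "ennreal \<tau> < 1" using that by (simp add: ennreal_less_one_iff)
        then have "ennreal \<tau> < f x \<longleftrightarrow> ennreal \<tau> < ennreal r" unfolding r(1)[symmetric] by simp
        then show ?thesis using that by (simp add: ennreal_less_iff)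
      qed
      then show "indicator {0..<1} \<tau> * indicator {x. ennreal \<tau> < f x} x = (indicator {0..<r} \<tau> :: ennreal)"
        using r(3) by (auto simp: indicator_def)
    qed
    then show ?thesis using r by simp
  qed
  then have "(\<integral>\<^sup>+x. min (f x) 1 \<partial>lborel)
      = (\<integral>\<^sup>+x. \<integral>\<^sup>+\<tau>. indicator {0..<1} \<tau> * indicator {x. ennreal \<tau> < f x} x \<partial>lborel \<partial>lborel)" by simp
  also have "\<dots> = (\<integral>\<^sup>+\<tau>. \<integral>\<^sup>+x. indicator {0..<1} \<tau> * indicator {x. ennreal \<tau> < f x} x \<partial>lborel \<partial>lborel)"
    by (rule lborel_pair.Fubini') (simp add: indicator_def, measurable)
  finally show ?thesis by (simp add: nn_integral_cmult)
qed

text \<open>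
  If both suprema equal \<open>1\<close>, the superlevel sets at every level below \<open>1\<close> are nonempty, so that the
  Brunn--Minkowski inequality on the line applies level by level. The conclusion with an arithmetic mean
  is stronger than the one with a geometric mean, but it needs the normalisation.
\<close>
lemma prekopa_leindler_real_normalised:
  fixes f g h :: "real \<Rightarrow> ennreal"
  assumes [measurable]: "f \<in> borel_measurable borel" "g \<in> borel_measurable borel" "h \<in> borel_measurable borel"
    and bound: "\<And>x. f x \<le> 1" "\<And>x. g x \<le> 1"
    and sup: "\<And>\<tau>. \<tau> < 1 \<Longrightarrow> \<exists>x. \<tau> < f x" "\<And>\<tau>. \<tau> < 1 \<Longrightarrow> \<exists>x. \<tau> < g x"
    and mid: "\<And>x y. f x * g y \<le> (h ((x + y) / 2))\<^sup>2"
  shows "(\<integral>\<^sup>+x. f x \<partial>lborel) + (\<integral>\<^sup>+x. g x \<partial>lborel) \<le> 2 * (\<integral>\<^sup>+x. h x \<partial>lborel)"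
proof -
  let ?m = "\<lambda>f. \<integral>\<^sup>+\<tau>. indicator {0..<1} \<tau> * emeasure lborel {x::real. ennreal \<tau> < f x} \<partial>lborel"
  have "(\<integral>\<^sup>+x. f x \<partial>lborel) + (\<integral>\<^sup>+x. g x \<partial>lborel) = ?m f + ?m g"
    using layer_cake[of f] layer_cake[of g] bound by (simp add: min_absorb1)
  also have "\<dots> = (\<integral>\<^sup>+\<tau>. indicator {0..<1} \<tau> * emeasure lborel {x. ennreal \<tau> < f x}
      + indicator {0..<1} \<tau> * emeasure lborel {x. ennreal \<tau> < g x} \<partial>lborel)"
    by (rule nn_integral_add[symmetric]) measurable
  also have "\<dots> \<le> (\<integral>\<^sup>+\<tau>. 2 * (indicator {0..<1} \<tau> * emeasure lborel {x. ennreal \<tau> < h x}) \<partial>lborel)"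
  proof (rule nn_integral_mono)
    fix \<tau> :: real
    have "emeasure lborel {x. ennreal \<tau> < f x} + emeasure lborel {x. ennreal \<tau> < g x}
        \<le> 2 * emeasure lborel {x. ennreal \<tau> < h x}" if \<tau>: "0 \<le> \<tau>" "\<tau> < 1"
    proof (rule brunn_minkowski_real)
      have "ennreal \<tau> < 1" using \<tau> by (simp add: ennreal_less_one_iff)
      then show "{x. ennreal \<tau> < f x} \<noteq> {}" "{x. ennreal \<tau> < g x} \<noteq> {}" using sup by auto
      fix x y assume "x \<in> {x. ennreal \<tau> < f x}" "y \<in> {x. ennreal \<tau> < g x}"
      then obtain r where r: "ennreal \<tau> < r" "r < min (f x) (g y)" using dense[of "ennreal \<tau>" "min (f x) (g y)"] by auto
      then have "r * r \<le> f x * g y" by (intro mult_mono) auto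
      also have "\<dots> \<le> (h ((x + y) / 2))\<^sup>2" by (rule mid)
      finally have "r \<le> h ((x + y) / 2)" unfolding power2_eq_square by (rule ennreal_square_le_imp_le)
      then have "ennreal \<tau> < h ((x + y) / 2)" using r(1) by simp
      then show "(x + y) / 2 \<in> {x. ennreal \<tau> < h x}" by simp
    qed auto
    then show "indicator {0..<1} \<tau> * emeasure lborel {x. ennreal \<tau> < f x}
        + indicator {0..<1} \<tau> * emeasure lborel {x. ennreal \<tau> < g x}
        \<le> 2 * (indicator {0..<1} \<tau> * emeasure lborel {x. ennreal \<tau> < h x})"
      by (auto simp: indicator_def)
  qed
  also have "\<dots> = 2 * (\<integral>\<^sup>+x. min (h x) 1 \<partial>lborel)"
    by (subst nn_integral_cmult) (measurable, simp add: layer_cake)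
  also have "\<dots> \<le> 2 * (\<integral>\<^sup>+x. h x \<partial>lborel)"
    by (intro mult_left_mono nn_integral_mono) auto
  finally show ?thesis .
qed

lemma four_mult_le_square_sum: "4 * (x * y) \<le> (x + y)\<^sup>2" for x y :: ennreal
proof (cases "x = top \<or> y = top")
  case True
  then show ?thesis by (auto simp: power2_eq_square ennreal_mult_top ennreal_top_mult)
next
  case False
  then obtain r s where rs: "x = ennreal r" "0 \<le> r" "y = ennreal s" "0 \<le> s"
    by (metis ennreal_cases)
  have "4 * (r * s) \<le> (r + s)\<^sup>2" using zero_le_power2[of "r - s"] by (simp add: power2_eq_square algebra_simps)
  then have "ennreal (4 * (r * s)) \<le> ennreal ((r + s)\<^sup>2)" by (rule ennreal_leI)
  then show ?thesis using rs by (simp add: ennreal_mult ennreal_power flip: ennreal_plus)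
qed

text \<open>
  The hypothesis and the conclusion are both homogeneous in \<open>f\<close> and in \<open>g\<close>, so each can be divided by
  its supremum; the inequality between the arithmetic and the geometric mean then gives the product
  form.
\<close>
lemma prekopa_leindler_real_bounded:
  fixes f g h :: "real \<Rightarrow> ennreal"
  assumes [measurable]: "f \<in> borel_measurable borel" "g \<in> borel_measurable borel" "h \<in> borel_measurable borel"
    and bound: "(SUP x. f x) < top" "(SUP x. g x) < top"
    and mid: "\<And>x y. f x * g y \<le> (h ((x + y) / 2))\<^sup>2"
  shows "(\<integral>\<^sup>+x. f x \<partial>lborel) * (\<integral>\<^sup>+x. g x \<partial>lborel) \<le> (\<integral>\<^sup>+x. h x \<partial>lborel)\<^sup>2"
proof (cases "(SUP x. f x) = 0 \<or> (SUP x. g x) = 0")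
  case True
  then have "(\<forall>x. f x = 0) \<or> (\<forall>x. g x = 0)" by (auto simp: SUP_eq_iff bot_ennreal[symmetric] SUP_bot_conv)
  then show ?thesis by auto
next
  case False
  obtain a b where a: "(SUP x. f x) = ennreal a" "0 < a" and b: "(SUP x. g x) = ennreal b" "0 < b"
    using bound False
    by (cases "SUP x. f x"; cases "SUP x. g x") (auto simp: less_top order_le_less)
  have ab: "0 < sqrt (a * b)" using a b by simp
  let ?f = "\<lambda>x. f x * ennreal (1/a)" and ?g = "\<lambda>x. g x * ennreal (1/b)" and ?h = "\<lambda>x. h x * ennreal (1 / sqrt (a*b))"
  have norm1: "u x * ennreal (1/c) \<le> 1" "\<tau> < 1 \<Longrightarrow> \<exists>x. \<tau> < u x * ennreal (1/c)"
    if c: "(SUP x. u x) = ennreal c" "0 < c" for u :: "real \<Rightarrow> ennreal" and c x \<tau>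
  proof -
    have S: "(SUP x. u x * ennreal (1/c)) = 1"
      using c by (subst SUP_mult_right_ennreal[symmetric]) (simp flip: ennreal_mult)
    then show "u x * ennreal (1/c) \<le> 1" by (metis SUP_upper UNIV_I)
    show "\<exists>x. \<tau> < u x * ennreal (1/c)" if "\<tau> < 1" using that unfolding S[symmetric] less_SUP_iff by auto
  qed
  have sq: "ennreal (1/a) * ennreal (1/b) = (ennreal (1 / sqrt (a*b)))\<^sup>2"
    using a b by (simp add: power2_eq_square flip: ennreal_mult)
  have scaled: "(\<integral>\<^sup>+x. ?f x \<partial>lborel) + (\<integral>\<^sup>+x. ?g x \<partial>lborel) \<le> 2 * (\<integral>\<^sup>+x. ?h x \<partial>lborel)"
  proof (rule prekopa_leindler_real_normalised)
    fix x y
    have "?f x * ?g y = (f x * g y) * (ennreal (1/a) * ennreal (1/b))" by (simp only: mult_ac)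
    also have "\<dots> \<le> (h ((x + y) / 2))\<^sup>2 * (ennreal (1 / sqrt (a*b)))\<^sup>2"
      unfolding sq using mid by (intro mult_right_mono) auto
    finally show "?f x * ?g y \<le> (?h ((x + y) / 2))\<^sup>2" by (simp add: power_mult_distrib)
  qed (use norm1[OF a] norm1[OF b] in auto)
  let ?If = "\<integral>\<^sup>+x. f x \<partial>lborel" and ?Ig = "\<integral>\<^sup>+x. g x \<partial>lborel" and ?Ih = "\<integral>\<^sup>+x. h x \<partial>lborel"
  have "4 * ((?If * ?Ig) * (ennreal (1 / sqrt (a*b)))\<^sup>2) = 4 * ((?If * ennreal (1/a)) * (?Ig * ennreal (1/b)))"
    unfolding sq[symmetric] by (simp only: mult_ac)
  also have "\<dots> \<le> (?If * ennreal (1/a) + ?Ig * ennreal (1/b))\<^sup>2" by (rule four_mult_le_square_sum)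
  also have "\<dots> \<le> (2 * (?Ih * ennreal (1 / sqrt (a*b))))\<^sup>2"
    using scaled by (intro power_mono) (auto simp: nn_integral_multc)
  also have "\<dots> = 4 * (?Ih\<^sup>2 * (ennreal (1 / sqrt (a*b)))\<^sup>2)" by (simp add: power_mult_distrib)
  finally have *: "4 * ((?If * ?Ig) * (ennreal (1 / sqrt (a*b)))\<^sup>2) \<le> 4 * (?Ih\<^sup>2 * (ennreal (1 / sqrt (a*b)))\<^sup>2)" .
  have one: "ennreal (a*b/4) * (4 * (z * (ennreal (1 / sqrt (a*b)))\<^sup>2)) = z" for z
  proof -
    have "ennreal (a*b/4) * (4 * (z * (ennreal (1 / sqrt (a*b)))\<^sup>2)) = z * ennreal (a*b/4 * 4 * (1/a) * (1/b))"
      unfolding sq[symmetric] using a b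
      by (simp only: ennreal_mult' mult_nonneg_nonneg divide_nonneg_pos less_imp_le ennreal_numeral[symmetric] mult_ac zero_le_one zero_le_numeral)
    also have "a*b/4 * 4 * (1/a) * (1/b) = 1" using a b by simp
    finally show ?thesis by simp
  qed
  show ?thesis using mult_left_mono[OF *, of "ennreal (a*b/4)"] unfolding one by simp
qed

lemma prekopa_leindler_real:
  fixes f g h :: "real \<Rightarrow> ennreal"
  assumes [measurable]: "f \<in> borel_measurable borel" "g \<in> borel_measurable borel" "h \<in> borel_measurable borel"
    and mid: "\<And>x y. f x * g y \<le> (h ((x + y) / 2))\<^sup>2"
  shows "(\<integral>\<^sup>+x. f x \<partial>lborel) * (\<integral>\<^sup>+x. g x \<partial>lborel) \<le> (\<integral>\<^sup>+x. h x \<partial>lborel)\<^sup>2"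
proof -
  have trunc: "(\<integral>\<^sup>+x. u x \<partial>lborel) = (SUP k. \<integral>\<^sup>+x. min (u x) (of_nat k) \<partial>lborel)"
    if [measurable]: "u \<in> borel_measurable borel" for u :: "real \<Rightarrow> ennreal"
  proof -
    have "u x = (SUP k. min (u x) (of_nat k))" for x
      by (simp add: inf_min[symmetric] inf_SUP[symmetric] ennreal_SUP_of_nat_eq_top)
    then have "(\<integral>\<^sup>+x. u x \<partial>lborel) = (\<integral>\<^sup>+x. (SUP k. min (u x) (of_nat k)) \<partial>lborel)" by simp
    also have "\<dots> = (SUP k. \<integral>\<^sup>+x. min (u x) (of_nat k) \<partial>lborel)"
      by (rule nn_integral_monotone_convergence_SUP) (auto simp: incseq_def le_fun_def intro: min.coboundedI2)
    finally show ?thesis .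
  qed
  have "(\<integral>\<^sup>+x. min (f x) (of_nat k) \<partial>lborel) * (\<integral>\<^sup>+x. min (g x) (of_nat l) \<partial>lborel) \<le> (\<integral>\<^sup>+x. h x \<partial>lborel)\<^sup>2" for k l :: nat
  proof (rule prekopa_leindler_real_bounded)
    have "(SUP x. min (u x) (of_nat k)) < top" for u :: "real \<Rightarrow> ennreal" and k :: nat
      by (rule le_less_trans[of _ "of_nat k"]) (auto intro!: SUP_least simp: of_nat_less_top)
    then show "(SUP x. min (f x) (of_nat k)) < top" "(SUP x. min (g x) (of_nat l)) < top" by auto
    show "min (f x) (of_nat k) * min (g y) (of_nat l) \<le> (h ((x + y) / 2))\<^sup>2" for x y
      by (rule order_trans[OF mult_mono mid]) auto
  qed auto
  then show ?thesis
    by (simp add: trunc[of f] trunc[of g] SUP_mult_right_ennreal SUP_mult_left_ennreal SUP_least)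
qed

text \<open>
  The Prekopa--Leindler inequality at the midpoint, by induction on the dimension: the hypothesis for
  the sections at the heights \<open>s\<close>, \<open>t\<close> and \<open>(s + t) / 2\<close> of the last coordinate makes their integrals
  satisfy the one-dimensional hypothesis. The squared form avoids roots in the extended reals.
\<close>
theorem prekopa_leindler:
  fixes f g h :: "('i \<Rightarrow> real) \<Rightarrow> ennreal"
  assumes "finite I"
    and "f \<in> borel_measurable (PiM I (\<lambda>_. lborel))" "g \<in> borel_measurable (PiM I (\<lambda>_. lborel))"
      "h \<in> borel_measurable (PiM I (\<lambda>_. lborel))"
    and "\<And>x y. x \<in> I \<rightarrow>\<^sub>E UNIV \<Longrightarrow> y \<in> I \<rightarrow>\<^sub>E UNIV \<Longrightarrow> f x * g y \<le> (h (\<lambda>i\<in>I. (x i + y i) / 2))\<^sup>2"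
  shows "(\<integral>\<^sup>+x. f x \<partial>PiM I (\<lambda>_. lborel)) * (\<integral>\<^sup>+x. g x \<partial>PiM I (\<lambda>_. lborel))
    \<le> (\<integral>\<^sup>+x. h x \<partial>PiM I (\<lambda>_. lborel))\<^sup>2"
  using assms
proof (induction I arbitrary: f g h rule: finite_induct)
  case empty
  interpret product_sigma_finite "\<lambda>_::'i. lborel::real measure" by standard
  have "(\<lambda>i. undefined) = (\<lambda>i\<in>{}. (undefined + undefined) / 2 :: real)" by auto
  then show ?case using empty(4)[of "\<lambda>_. undefined" "\<lambda>_. undefined"] by (simp add: nn_integral_empty)
next
  case (insert i I)
  interpret product_sigma_finite "\<lambda>_::'i. lborel::real measure" by standard
  interpret I: finite_product_sigma_finite "\<lambda>_::'i. lborel::real measure" I by standard fact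
  let ?M = "PiM I (\<lambda>_::'i. lborel::real measure)"
  note [measurable] = insert.prems(1-3)
  have sect: "(\<lambda>x. u (x(i := t))) \<in> borel_measurable ?M"
    and marg: "(\<lambda>t. \<integral>\<^sup>+x. u (x(i := t)) \<partial>?M) \<in> borel_measurable borel"
    if [measurable]: "u \<in> borel_measurable (PiM (insert i I) (\<lambda>_. lborel))" for u :: "_ \<Rightarrow> ennreal" and t
  proof -
    show "(\<lambda>x. u (x(i := t))) \<in> borel_measurable ?M"
      by (rule measurable_compose[OF _ that], rule measurable_fun_upd) auto
    have "(\<lambda>(t, x). u (x(i := t))) \<in> borel_measurable (lborel \<Otimes>\<^sub>M ?M)" by measurable
    from I.borel_measurable_nn_integral[OF this]
    show "(\<lambda>t. \<integral>\<^sup>+x. u (x(i := t)) \<partial>?M) \<in> borel_measurable borel" by simp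
  qed
  have "(\<integral>\<^sup>+t. \<integral>\<^sup>+x. f (x(i := t)) \<partial>?M \<partial>lborel) * (\<integral>\<^sup>+t. \<integral>\<^sup>+x. g (x(i := t)) \<partial>?M \<partial>lborel)
      \<le> (\<integral>\<^sup>+t. \<integral>\<^sup>+x. h (x(i := t)) \<partial>?M \<partial>lborel)\<^sup>2"
  proof (rule prekopa_leindler_real)
    fix s t :: real
    show "(\<integral>\<^sup>+x. f (x(i := s)) \<partial>?M) * (\<integral>\<^sup>+x. g (x(i := t)) \<partial>?M) \<le> (\<integral>\<^sup>+x. h (x(i := (s + t) / 2)) \<partial>?M)\<^sup>2"
    proof (rule insert.IH)
      fix x y :: "'i \<Rightarrow> real" assume xy: "x \<in> I \<rightarrow>\<^sub>E UNIV" "y \<in> I \<rightarrow>\<^sub>E UNIV"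
      have "(\<lambda>j\<in>I. (x j + y j) / 2)(i := (s + t) / 2) = (\<lambda>j\<in>insert i I. ((x(i := s)) j + (y(i := t)) j) / 2)"
        using insert.hyps(2) by (auto simp: fun_eq_iff)
      then show "f (x(i := s)) * g (y(i := t)) \<le> (h ((\<lambda>j\<in>I. (x j + y j) / 2)(i := (s + t) / 2)))\<^sup>2"
        using insert.prems(4)[of "x(i := s)" "y(i := t)"] xy
        by (simp del: fun_upd_apply add: PiE_fun_upd restrict_def)
    qed (intro sect insert.prems)+
  qed (auto intro: marg insert.prems)
  then show ?case using insert.hyps insert.prems(1-3) by (simp add: product_nn_integral_insert_rev)
qed

section \<open>Planar log-concave functions with centroid at the origin\<close>

text \<open>
  Iterated midpoints of two points are the dyadic points of the segment between them, and these are
  dense in it.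
\<close>
lemma closed_midpoint_imp_convex:
  fixes S :: "'a::real_normed_vector set"
  assumes S: "closed S" and mid: "\<And>x y. x \<in> S \<Longrightarrow> y \<in> S \<Longrightarrow> midpoint x y \<in> S"
  shows "convex S"
proof (rule convexI)
  fix x y :: 'a and u v :: real
  assume xy: "x \<in> S" "y \<in> S" and uv: "0 \<le> u" "0 \<le> v" "u + v = 1"
  define line where "line t = x + t *\<^sub>R (y - x)" for t :: real
  have dyadic: "line (real k / 2^n) \<in> S" if "k \<le> 2^n" for k n :: nat
    using that
  proof (induction n arbitrary: k)
    case 0
    then have "k = 0 \<or> k = 1" by auto
    then show ?case using xy by (auto simp: line_def)
  next
    case (Suc n)
    let ?i = "k div 2" and ?j = "k - k div 2"
    have "?i \<le> 2^n" "?j \<le> 2^n" using Suc.prems by auto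
    then have "midpoint (line (real ?i / 2^n)) (line (real ?j / 2^n)) \<in> S"
      using Suc.IH mid by blast
    moreover have "midpoint (line (real ?i / 2^n)) (line (real ?j / 2^n)) = line (real k / 2^Suc n)"
    proof -
      have "real k = real ?i + real ?j" by simp
      then have "(real ?i / 2^n + real ?j / 2^n) / 2 = real k / 2^Suc n"
        by (simp add: add_divide_distrib[symmetric] mult.commute)
      moreover have "midpoint (line s) (line t) = line ((s + t) / 2)" for s t
        unfolding midpoint_eq_iff by (simp add: line_def algebra_simps flip: scaleR_add_left)
      ultimately show ?thesis by (simp add: mult.commute)
    qed
    ultimately show ?case by simp
  qed
  define a where "a n = real (nat \<lfloor>v * 2^n\<rfloor>) / 2^n" for n :: nat
  have "nat \<lfloor>v * 2^n\<rfloor> \<le> 2^n" for n :: nat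
  proof -
    have "v * 2^n \<le> 2^n" using uv by (simp add: mult_left_le_one_le)
    then have "\<lfloor>v * 2^n\<rfloor> \<le> \<lfloor>2^n :: real\<rfloor>" by (rule floor_mono)
    also have "\<dots> = 2^n" by (metis floor_of_int of_int_numeral of_int_power)
    finally show ?thesis by (simp add: nat_le_iff)
  qed
  then have "\<And>n. line (a n) \<in> S" unfolding a_def by (rule dyadic)
  moreover have "a \<longlonglongrightarrow> v"
  proof (rule LIMSEQ_I)
    fix r :: real assume "0 < r"
    then obtain N where N: "(1/2)^N < r" using real_arch_pow_inv[of r "1/2"] by auto
    have "norm (a n - v) < r" if "N \<le> n" for n
    proof -
      have "real (nat \<lfloor>v * 2^n\<rfloor>) = of_int \<lfloor>v * 2^n\<rfloor>" using uv by simp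
      then have "a n * 2^n = of_int \<lfloor>v * 2^n\<rfloor>" by (simp add: a_def)
      then have "v * 2^n - 1 < a n * 2^n" "a n * 2^n \<le> v * 2^n" by linarith+
      then have "\<bar>a n - v\<bar> * 2^n \<le> 1" by (simp add: abs_if algebra_simps)
      then have "\<bar>a n - v\<bar> \<le> (1/2)^n" by (simp add: power_divide field_simps)
      also have "\<dots> \<le> (1/2)^N" using that by (rule power_decreasing) auto
      finally show ?thesis using N by simp
    qed
    then show "\<exists>N. \<forall>n\<ge>N. norm (a n - v) < r" by blast
  qed
  then have "(\<lambda>n. line (a n)) \<longlonglongrightarrow> line v" unfolding line_def by (intro tendsto_intros)
  ultimately have "line v \<in> S" by (rule closed_sequentially[OF S])
  moreover have "line v = u *\<^sub>R x + v *\<^sub>R y"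
    using uv(3) by (simp add: line_def algebra_simps) (metis scaleR_add_left scaleR_one)
  ultimately show "u *\<^sub>R x + v *\<^sub>R y \<in> S" by simp
qed

lemma lborel_integral_dilation:
  fixes f :: "real \<times> real \<Rightarrow> real"
  assumes [measurable]: "f \<in> borel_measurable borel"
  shows "(\<integral>x. f x \<partial>lborel) = 4 * (\<integral>x. f (2 *\<^sub>R x - z) \<partial>lborel)"
proof -
  have "(\<integral>x. f x \<partial>lborel) = (\<integral>x. f x \<partial>density (distr lborel borel (\<lambda>x. - z + 2 *\<^sub>R x)) (\<lambda>_. ennreal (\<bar>2\<bar>^DIM(real\<times>real))))"
    by (rule arg_cong2[OF lborel_affine refl, where f = lebesgue_integral]) simp
  also have "\<dots> = (\<integral>x. 4 * f (- z + 2 *\<^sub>R x) \<partial>lborel)"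
    by (subst integral_density) (auto simp: integral_distr)
  finally show ?thesis by simp
qed

lemma midpoint_dilation [simp]: "midpoint (2 *\<^sub>R x - z) z = (x::'a::real_vector)"
  by (simp add: midpoint_def scaleR_right.add)

text \<open>
  Closedness of the superlevel sets is upper semicontinuity. Together with log-concavity at midpoints it
  makes these sets convex.
\<close>
locale centred_log_concave =
  fixes F :: "real \<times> real \<Rightarrow> real"
  assumes nonneg: "0 \<le> F p"
    and measurable [measurable]: "F \<in> borel_measurable borel"
    and log_concave: "F p * F q \<le> (F (midpoint p q))\<^sup>2"
    and closed_superlevel: "0 < c \<Longrightarrow> closed {p. c \<le> F p}"
    and bounded_above: "\<exists>B. \<forall>p. F p \<le> B"
    and bounded_support: "bounded {p. F p \<noteq> 0}"
    and mass: "0 < (\<integral>p. F p \<partial>lborel)"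
    and centred: "(\<integral>p. (a \<bullet> p) * F p \<partial>lborel) = 0"
begin

lemma integrable_weighted:
  assumes [measurable]: "\<phi> \<in> borel_measurable borel"
    and \<phi>: "\<And>p. \<bar>\<phi> p\<bar> \<le> A + C * norm p" and C: "0 \<le> C"
  shows "integrable lborel (\<lambda>p. \<phi> p * F p)"
proof -
  obtain R where R: "\<And>p. F p \<noteq> 0 \<Longrightarrow> norm p \<le> R"
    using bounded_support by (auto simp: bounded_iff)
  obtain B where B: "\<And>p. F p \<le> B" using bounded_above by auto
  show ?thesis
  proof (rule Bochner_Integration.integrable_bound)
    show "integrable lborel (\<lambda>p. ((A + C * R) * B) * indicator (cball (0::real\<times>real) R) p)"
      by (intro integrable_mult_right integrable_real_indicator)
         (use emeasure_bounded_finite[OF bounded_cball] in \<open>auto simp: less_top\<close>)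
    show "AE p in lborel. norm (\<phi> p * F p) \<le> norm ((A + C * R) * B * indicator (cball 0 R) p)"
    proof (rule AE_I2)
      fix p
      show "norm (\<phi> p * F p) \<le> norm ((A + C * R) * B * indicator (cball 0 R) p)"
      proof (cases "F p = 0")
        case False
        have "A + C * norm p \<le> A + C * R" using R[OF False] C by (simp add: mult_left_mono)
        then have "\<bar>\<phi> p\<bar> \<le> A + C * R" using \<phi>[of p] by linarith
        then have "\<bar>\<phi> p\<bar> * F p \<le> (A + C * R) * B"
          using B[of p] nonneg[of p] by (intro mult_mono) auto
        also have "\<dots> \<le> \<bar>(A + C * R) * B\<bar>" by simp
        finally show ?thesis using R[OF False] nonneg[of p] by (simp add: abs_mult)
      qed simp
    qed
  qed simp
qed

text \<open>
  The basic comparison of the planar argument. The substitution \<open>p \<mapsto> 2 p - z\<close> has Jacobian \<open>4\<close>, and it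
  turns \<open>F p\<close> into \<open>F (2 p - z)\<close>, which is at most \<open>k * F p\<close> because \<open>p\<close> is the midpoint of \<open>2 p - z\<close>
  and \<open>z\<close>.
\<close>
lemma contraction:
  assumes [measurable]: "\<phi> \<in> borel_measurable borel"
    and growth: "\<And>p. \<bar>\<phi> p\<bar> \<le> A + C * norm p" "0 \<le> C"
    and \<phi>: "\<And>p. 0 \<le> \<phi> p" and contr: "\<And>p. \<phi> p \<noteq> 0 \<Longrightarrow> F p \<le> k * F (midpoint p z)"
  shows "(\<integral>p. \<phi> p * F p \<partial>lborel) \<le> 4 * k * (\<integral>p. \<phi> (2 *\<^sub>R p - z) * F p \<partial>lborel)"
proof -
  let ?D = "\<lambda>p. 2 *\<^sub>R p - z"
  have "(\<integral>p. \<phi> p * F p \<partial>lborel) = 4 * (\<integral>p. \<phi> (?D p) * F (?D p) \<partial>lborel)"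
    by (rule lborel_integral_dilation) measurable
  also have "(\<integral>p. \<phi> (?D p) * F (?D p) \<partial>lborel) \<le> (\<integral>p. k * (\<phi> (?D p) * F p) \<partial>lborel)"
  proof (rule integral_mono')
    show "integrable lborel (\<lambda>p. k * (\<phi> (?D p) * F p))"
    proof (intro integrable_mult_right integrable_weighted)
      fix p
      have "norm (?D p) \<le> 2 * norm p + norm z" by (rule order_trans[OF norm_triangle_ineq4]) simp
      then have "C * norm (?D p) \<le> C * (2 * norm p + norm z)" using growth(2) by (rule mult_left_mono)
      then show "\<bar>\<phi> (?D p)\<bar> \<le> (A + C * norm z) + (2 * C) * norm p"
        using growth(1)[of "?D p"] by (simp add: algebra_simps)
      show "0 \<le> 2 * C" using growth(2) by simp
    qed measurable
  next
    fix p
    show "\<phi> (?D p) * F (?D p) \<le> k * (\<phi> (?D p) * F p)"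
    proof (cases "\<phi> (?D p) = 0")
      case False
      then have "F (?D p) \<le> k * F p" using contr[of "?D p"] by simp
      then have "\<phi> (?D p) * F (?D p) \<le> \<phi> (?D p) * (k * F p)" using \<phi> by (rule mult_left_mono)
      then show ?thesis by (simp add: algebra_simps)
    qed simp
    then show "0 \<le> k * (\<phi> (?D p) * F p)"
      using \<phi>[of "?D p"] nonneg[of "?D p"] by (meson mult_nonneg_nonneg order_trans)
  qed
  finally show ?thesis by simp
qed

lemma positive_weight:
  assumes [measurable]: "\<phi> \<in> borel_measurable borel"
    and growth: "\<And>p. \<bar>\<phi> p\<bar> \<le> A + C * norm p" "0 \<le> C"
    and pos: "AE p in lborel. 0 < \<phi> p"
  shows "0 < (\<integral>p. \<phi> p * F p \<partial>lborel)"
proof (rule ccontr)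
  assume *: "\<not> 0 < (\<integral>p. \<phi> p * F p \<partial>lborel)"
  have nn: "AE p in lborel. 0 \<le> \<phi> p * F p"
    using pos by eventually_elim (auto simp: nonneg)
  then have "(\<integral>p. \<phi> p * F p \<partial>lborel) \<ge> 0" by (rule integral_nonneg_AE)
  with * have "(\<integral>p. \<phi> p * F p \<partial>lborel) = 0" by simp
  then have "AE p in lborel. \<phi> p * F p = 0"
    using integral_nonneg_eq_0_iff_AE[OF integrable_weighted[OF _ growth] nn] by simp
  with pos have "AE p in lborel. F p = 0" by eventually_elim auto
  then have "(\<integral>p. F p \<partial>lborel) = 0" by (rule integral_eq_zero_AE)
  with mass show False by simp
qed

definition moment :: "real \<Rightarrow> real \<times> real \<Rightarrow> real set \<Rightarrow> real" where
  "moment r a A = (\<integral>p. (indicator A (r + a \<bullet> p) * (r + a \<bullet> p)) * F p \<partial>lborel)"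

lemma affine_growth: "\<bar>r + a \<bullet> p\<bar> \<le> \<bar>r\<bar> + norm a * norm (p::real\<times>real)"
  using Cauchy_Schwarz_ineq2[of a p] by linarith

lemma moment_growth: "\<bar>indicator A (r + a \<bullet> p) * (r + a \<bullet> p)\<bar> \<le> \<bar>r\<bar> + norm a * norm (p::real\<times>real)"
  using affine_growth[of r a p] by (auto simp: indicator_def)

lemma integrable_moment:
  assumes [measurable]: "A \<in> sets borel"
  shows "integrable lborel (\<lambda>p. (indicator A (r + a \<bullet> p) * (r + a \<bullet> p)) * F p)"
  by (rule integrable_weighted[OF _ moment_growth]) auto

lemma integrable_affine: "integrable lborel (\<lambda>p. (r + a \<bullet> p) * F p)"
  by (rule integrable_weighted[OF _ affine_growth]) auto

lemma integrable: "integrable lborel F"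
  using integrable_weighted[of "\<lambda>_. 1" 1 0] by simp

lemma integral_affine: "(\<integral>p. (r + a \<bullet> p) * F p \<partial>lborel) = r * (\<integral>p. F p \<partial>lborel)"
proof -
  have "(\<integral>p. (r + a \<bullet> p) * F p \<partial>lborel) = (\<integral>p. r * F p + (0 + a \<bullet> p) * F p \<partial>lborel)"
    by (simp add: algebra_simps)
  also have "\<dots> = r * (\<integral>p. F p \<partial>lborel)"
    using integrable integrable_affine[of 0 a] centred[of a] by (subst Bochner_Integration.integral_add) auto
  finally show ?thesis .
qed

lemma moment_Un:
  assumes "A \<in> sets borel" "B \<in> sets borel" "A \<inter> B = {}"
  shows "moment r a (A \<union> B) = moment r a A + moment r a B"
proof -
  have "moment r a (A \<union> B) = (\<integral>p. (indicator A (r + a \<bullet> p) * (r + a \<bullet> p)) * F p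
      + (indicator B (r + a \<bullet> p) * (r + a \<bullet> p)) * F p \<partial>lborel)"
    unfolding moment_def by (intro Bochner_Integration.integral_cong refl) (use assms(3) in \<open>auto simp: indicator_def\<close>)
  then show ?thesis unfolding moment_def
    using integrable_moment assms by (simp add: Bochner_Integration.integral_add)
qed

lemma moment_nonneg: "A \<subseteq> {0..} \<Longrightarrow> 0 \<le> moment r a A"
  unfolding moment_def by (intro Bochner_Integration.integral_nonneg) (auto simp: indicator_def nonneg)

text \<open>
  The dilation from a zero \<open>z\<close> of the affine function doubles the values of this function; together
  with the Jacobian this makes the factor \<open>8\<close>. When \<open>8 * k < 1\<close> and \<open>A\<close> is a half-line, the moment
  beyond a threshold is therefore controlled by the moment just below it.
\<close>
lemma moment_contraction:
  assumes A: "A \<in> sets borel" "A \<subseteq> {0..}" and z: "r + a \<bullet> z = 0"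
    and contr: "\<And>p. r + a \<bullet> p \<in> A \<Longrightarrow> F p \<le> k * F (midpoint p z)"
  shows "moment r a A \<le> 8 * k * moment r a {x. 2 * x \<in> A}"
proof -
  have [measurable]: "A \<in> sets borel" by fact
  have D: "r + a \<bullet> (2 *\<^sub>R p - z) = 2 * (r + a \<bullet> p)" for p
    using z by (simp add: inner_diff_right)
  have "moment r a A \<le> 4 * k * (\<integral>p. (indicator A (r + a \<bullet> (2 *\<^sub>R p - z)) * (r + a \<bullet> (2 *\<^sub>R p - z))) * F p \<partial>lborel)"
    unfolding moment_def
    by (rule contraction[OF _ moment_growth]) (use A contr in \<open>auto simp: indicator_def\<close>)
  also have "\<dots> = 4 * k * (\<integral>p. 2 * ((indicator {x. 2 * x \<in> A} (r + a \<bullet> p) * (r + a \<bullet> p)) * F p) \<partial>lborel)"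
    unfolding D indicator_def mem_Collect_eq by (simp only: mult.left_commute mult.assoc)
  finally show ?thesis by (simp add: moment_def)
qed

text \<open>
  Where \<open>F\<close> is small compared with its value at \<open>q\<close>, log-concavity forces it to be much larger at the
  midpoint with \<open>q\<close>.
\<close>
lemma decay:
  assumes "F p \<le> k\<^sup>2 * F q" "0 \<le> k"
  shows "F p \<le> k * F (midpoint p q)"
proof (rule power2_le_imp_le)
  have "(F p)\<^sup>2 \<le> F p * (k\<^sup>2 * F q)"
    unfolding power2_eq_square[of "F p"] using assms(1) nonneg by (rule mult_left_mono)
  also have "\<dots> \<le> k\<^sup>2 * (F (midpoint p q))\<^sup>2"
    using mult_left_mono[OF log_concave[of p q], of "k\<^sup>2"] by (simp add: mult_ac)
  finally show "(F p)\<^sup>2 \<le> (k * F (midpoint p q))\<^sup>2" by (simp add: power_mult_distrib)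
qed (use assms(2) nonneg in simp)

lemma superlevel_convex:
  assumes "0 < c" shows "convex {p. c \<le> F p}"
proof (rule closed_midpoint_imp_convex[OF closed_superlevel[OF assms]])
  fix p q assume "p \<in> {p. c \<le> F p}" "q \<in> {p. c \<le> F p}"
  then have "c * c \<le> F p * F q" using assms by (intro mult_mono) auto
  then have "c\<^sup>2 \<le> (F (midpoint p q))\<^sup>2" using log_concave[of p q] by (simp add: power2_eq_square)
  then have "c \<le> F (midpoint p q)" using nonneg by (rule power2_le_imp_le)
  then show "midpoint p q \<in> {p. c \<le> F p}" by simp
qed

text \<open>
  A point at which \<open>F\<close> is at least half its supremum serves as well as a maximum point.
\<close>
lemma half_maximal_point: "\<exists>z. 0 < F z \<and> (\<forall>p. F p \<le> 2 * F z)"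
proof -
  obtain B where "\<forall>p. F p \<le> B" using bounded_above by blast
  then have bdd: "bdd_above (range F)" unfolding bdd_above_def by blast
  obtain q where q: "0 < F q"
  proof -
    have "\<exists>q. F q \<noteq> 0"
    proof (rule ccontr)
      assume "\<not> ?thesis"
      then have "F = (\<lambda>_. 0)" by blast
      then show False using mass by simp
    qed
    then obtain q where "F q \<noteq> 0" by blast
    then show ?thesis using that[of q] nonneg[of q] by simp
  qed
  have S: "0 < (SUP p. F p)" using q cSUP_upper[OF UNIV_I bdd] by (rule less_le_trans)
  then have "(SUP p. F p) / 2 < (SUP p. F p)" by simp
  then obtain z where "(SUP p. F p) / 2 < F z" using less_cSUP_iff[OF UNIV_not_empty bdd] by blast
  moreover have "F p \<le> (SUP p. F p)" for p using cSUP_upper[OF UNIV_I bdd] by simp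
  ultimately have "F p \<le> 2 * F z" for p by (smt (verit) field_sum_of_halves)
  moreover have "0 < F z" using S \<open>(SUP p. F p) / 2 < F z\<close> by linarith
  ultimately show ?thesis by blast
qed

text \<open>
  At the centroid \<open>F\<close> has at least a fixed fraction of its supremum. Otherwise a line separates the
  centroid from a superlevel set that contains a nearly maximal point \<open>z\<close>. Let \<open>\<rho>\<close> be the affine
  function that is \<open>0\<close> at \<open>z\<close> and \<open>1\<close> at the centroid, hence has mean \<open>1\<close>. As \<open>F\<close> is tiny on
  \<open>\<rho> \<ge> 1\<close>, contraction towards \<open>z\<close> shows that the moment of \<open>\<rho>\<close> there is less than its moment on
  \<open>1/4 \<le> \<rho> < 1/2\<close>. But the mean of \<open>1 - \<rho>\<close> vanishes, which forces the opposite inequality.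
\<close>
lemma centroid_value: "F p \<le> 2^17 * F 0"
proof -
  obtain z where z: "0 < F z" "\<And>p. F p \<le> 2 * F z" using half_maximal_point by auto
  have "F z \<le> 2^16 * F 0"
  proof (rule ccontr)
    assume contra: "\<not> F z \<le> 2^16 * F 0"
    let ?L = "{p. F z / 2^16 \<le> F p}"
    have "convex ?L" "closed ?L" "0 \<notin> ?L"
    proof -
      have "0 < F z / 2^16" using z(1) by simp
      then show "convex ?L" "closed ?L" by (rule superlevel_convex, rule closed_superlevel)
      show "0 \<notin> ?L" using contra by simp
    qed
    then obtain a b where ab: "0 < b" "\<And>p. p \<in> ?L \<Longrightarrow> b < a \<bullet> p"
      using separating_hyperplane_closed_0[of ?L] by blast
    have "b < a \<bullet> z" by (rule ab) (use z in auto)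
    then have \<tau>: "0 < a \<bullet> z" using ab(1) by linarith
    define a' where "a' = (- 1 / (a \<bullet> z)) *\<^sub>R a"
    have \<rho>: "1 + a' \<bullet> p = 1 - (a \<bullet> p) / (a \<bullet> z)" for p by (simp add: a'_def)
    have \<rho>z: "1 + a' \<bullet> z = 0" using \<tau> by (simp add: \<rho>)
    have low: "F p \<le> (1/256)\<^sup>2 * F z" if "1 \<le> 1 + a' \<bullet> p" for p
    proof -
      have "a \<bullet> p \<le> 0" using that \<tau> by (simp add: \<rho> divide_le_0_iff)
      then have "p \<notin> ?L" using ab by fastforce
      then show ?thesis by (simp add: power2_eq_square)
    qed
    let ?I1 = "moment 1 a' {1/4..<1/2}" and ?I2 = "moment 1 a' {1/2..<1}" and ?J = "moment 1 a' {1..}"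
    \<comment> \<open>Beyond the separating line a contraction towards \<open>z\<close> gains \<open>1/256\<close>, the square root of the level \<open>1/2^16\<close>.\<close>
    have "?J \<le> 8 * (1/256) * moment 1 a' {x. 2 * x \<in> {1..}}"
      by (rule moment_contraction[OF _ _ \<rho>z]) (simp, simp, intro decay low, simp_all only: atLeast_iff)
    also have "{x::real. 2 * x \<in> {1..}} = {1/2..<1} \<union> {1..}" by auto
    also have "moment 1 a' \<dots> = ?I2 + ?J" by (rule moment_Un) auto
    finally have J: "31 * ?J \<le> ?I2" by simp
    \<comment> \<open>Before this line nothing is gained, but since \<open>z\<close> is nearly maximal little is lost.\<close>
    have "?I2 \<le> 8 * 2 * moment 1 a' {x. 2 * x \<in> {1/2..<1}}"
    proof (rule moment_contraction[OF _ _ \<rho>z])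
      fix p
      have "F p \<le> 2\<^sup>2 * F z" using z(2)[of p] z(1) by (simp add: power2_eq_square)
      then show "F p \<le> 2 * F (midpoint p z)" by (rule decay) simp
    qed auto
    also have "{x::real. 2 * x \<in> {1/2..<1}} = {1/4..<1/2}" by auto
    finally have I2: "?I2 \<le> 16 * ?I1" by simp
    let ?\<psi> = "\<lambda>p. indicator {1..} (1 + a' \<bullet> p) * (1 + a' \<bullet> p) + (0 + (- a') \<bullet> p)"
    \<comment> \<open>The weight is positive, since \<open>- (a' \<bullet> p)\<close> is \<open>1\<close> minus the value \<open>\<rho>\<close> of the affine function.\<close>
    have int: "(\<integral>p. ?\<psi> p * F p \<partial>lborel) = ?J"
    proof -
      have "(\<integral>p. ?\<psi> p * F p \<partial>lborel) = (\<integral>p. (indicator {1..} (1 + a' \<bullet> p) * (1 + a' \<bullet> p)) * F p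
          + (0 + (- a') \<bullet> p) * F p \<partial>lborel)"
        by (intro Bochner_Integration.integral_cong refl) (simp add: algebra_simps)
      also have "\<dots> = ?J + 0 * (\<integral>p. F p \<partial>lborel)"
        unfolding moment_def integral_affine[of 0 "- a'", symmetric]
        by (rule Bochner_Integration.integral_add[OF integrable_moment integrable_affine]) simp
      finally show ?thesis by simp
    qed
    have growth: "\<bar>?\<psi> p\<bar> \<le> 1 + (2 * norm a') * norm p" for p
      using moment_growth[of "{1..}" 1 a' p] affine_growth[of 0 "-a'" p] by simp
    have "0 < (\<integral>p. ?\<psi> p * F p \<partial>lborel)"
      by (rule positive_weight[OF _ growth]) (auto simp: indicator_def)
    then have Jpos: "0 < ?J" using int by simp
    have I1: "?I1 \<le> ?J"
    proof -
      have "?I1 \<le> (\<integral>p. ?\<psi> p * F p \<partial>lborel)" unfolding moment_def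
      proof (rule integral_mono)
        show "integrable lborel (\<lambda>p. ?\<psi> p * F p)" by (rule integrable_weighted[OF _ growth]) auto
        fix p show "indicator {1/4..<1/2} (1 + a' \<bullet> p) * (1 + a' \<bullet> p) * F p \<le> ?\<psi> p * F p"
          by (rule mult_right_mono[OF _ nonneg]) (auto simp: indicator_def)
      qed (auto intro: integrable_moment)
      then show ?thesis using int by simp
    qed
    show False using Jpos I1 J I2 by linarith
  qed
  have "F p \<le> 2 * F z" by (rule z(2))
  also have "\<dots> \<le> 2 * (2^16 * F 0)" using \<open>F z \<le> 2^16 * F 0\<close> by (rule mult_left_mono) simp
  also have "\<dots> = 2^17 * F 0" by simp
  finally show ?thesis .
qed

lemma centroid_pos: "0 < F 0"
proof -
  obtain z where "0 < F z" using half_maximal_point by blast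
  then have "0 < 2^17 * F 0" using centroid_value[of z] by (rule less_le_trans)
  then show ?thesis by (simp add: zero_less_mult_iff)
qed

text \<open>
  Outside the core \<open>decay\<close> towards the origin gains the factor \<open>1/16\<close>, the square root of the fraction
  chosen here; the factor of \<open>moment_contraction\<close> is then \<open>8 / 16 = 1/2\<close>.
\<close>
definition "core = {p. F 0 / 2^8 \<le> F p}"

lemma core: "convex core" "closed core" "0 \<in> core"
proof -
  have "0 < F 0 / 2^8" using centroid_pos by simp
  then show "convex core" "closed core"
    using superlevel_convex closed_superlevel unfolding core_def by blast+
  have "F 0 * 1 \<le> F 0 * 2^8" using nonneg by (intro mult_left_mono) auto
  then have "F 0 / 2^8 \<le> F 0" by (intro mult_imp_div_pos_le) auto
  then show "0 \<in> core" unfolding core_def by blast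
qed

lemma outside_core: "p \<notin> core \<Longrightarrow> F p \<le> 1/16 * F (midpoint p 0)"
  by (rule decay) (auto simp: core_def power2_eq_square)

text \<open>
  Hence \<open>F\<close> is not concentrated on a line, and every nonzero linear functional has a positive moment on
  its positive side.
\<close>
lemma AE_off_line: "a \<noteq> 0 \<Longrightarrow> AE p in lborel. a \<bullet> p \<noteq> (0::real)" for a :: "real \<times> real"
proof -
  assume "a \<noteq> 0"
  then have "negligible {p. a \<bullet> p = 0}" by (rule negligible_hyperplane[OF disjI1])
  then have "{p. a \<bullet> p = 0} \<in> null_sets lebesgue" by (simp add: negligible_iff_null_sets)
  then have "{p. a \<bullet> p = 0} \<in> null_sets lborel"
    by (subst (asm) null_sets_completion_iff) (auto simp: null_sets_def)
  then show ?thesis by (rule AE_I') auto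
qed

lemma positive_part: 
  assumes "a \<noteq> 0" shows "0 < moment 0 a {0<..}"
proof -
  have *: "\<bar>\<bar>a \<bullet> p\<bar>\<bar> \<le> 0 + norm a * norm p" for p using affine_growth[of 0 a p] by simp
  have "0 < (\<integral>p. \<bar>a \<bullet> p\<bar> * F p \<partial>lborel)"
    by (rule positive_weight[OF _ *]) (use AE_off_line[OF assms] in auto)
  also have "\<dots> = (\<integral>p. 2 * ((indicator {0<..} (0 + a \<bullet> p) * (0 + a \<bullet> p)) * F p) - (0 + a \<bullet> p) * F p \<partial>lborel)"
    by (intro Bochner_Integration.integral_cong refl) (auto simp: indicator_def)
  also have "\<dots> = 2 * moment 0 a {0<..} - 0 * (\<integral>p. F p \<partial>lborel)"
    unfolding integral_affine[symmetric, of 0 a] moment_def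
    using integrable_moment[of "{0<..}" 0 a] integrable_affine[of 0 a]
    by (subst Bochner_Integration.integral_diff) (auto intro!: integrable_mult_right simp del: add_0)
  finally show ?thesis by simp
qed

text \<open>
  Otherwise some nonzero linear functional is nonpositive on the core. Outside the core one contraction
  towards the origin gains the factor \<open>1/16\<close>, which beats the factor \<open>8\<close>, so the positive part of this
  functional would have a moment at most half of itself.
\<close>
lemma centroid_interior_core: "0 \<in> interior core"
proof (rule ccontr)
  assume out: "0 \<notin> interior core"
  obtain a where a: "a \<noteq> 0" "\<And>p. p \<in> core \<Longrightarrow> a \<bullet> p \<le> 0"
  proof (cases "interior core = {}")
    case True
    then obtain a b where ab: "a \<noteq> 0" "core \<subseteq> {p. a \<bullet> p = b}"
      using empty_interior_subset_hyperplane[OF core(1)] by blast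
    then have "b = 0" using core(3) by auto
    then show ?thesis using ab that by fastforce
  next
    case False
    have "0 \<notin> rel_interior core" using out rel_interior_nonempty_interior[OF False] by simp
    moreover have "0 \<in> closure core" using core(3) closure_subset by blast
    ultimately obtain a where a: "a \<noteq> 0" "\<And>p. p \<in> closure core \<Longrightarrow> a \<bullet> 0 \<le> a \<bullet> p"
      using supporting_hyperplane_rel_boundary[OF core(1) core(3)] core(2) by (metis closure_closed)
    show ?thesis by (rule that[of "-a"]) (use a closure_subset in auto)
  qed
  have "moment 0 a {0<..} \<le> 8 * (1/16) * moment 0 a {x. 2 * x \<in> {0<..}}"
  proof (rule moment_contraction[where z = 0])
    fix p assume "0 + a \<bullet> p \<in> {0<..}"
    then have "p \<notin> core" using a(2)[of p] by auto
    then show "F p \<le> 1/16 * F (midpoint p 0)" by (rule outside_core)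
  qed auto
  also have "{x::real. 2 * x \<in> {0<..}} = {0<..}" by auto
  finally show False using positive_part[OF a(1)] by simp
qed

text \<open>
  The heart of the argument: if the core ends before \<open>H\<close> in the direction \<open>e\<close>, it cannot reach much
  further than \<open>H\<close> in the direction \<open>- e\<close>. Separate \<open>H e\<close> from the core by a line and let \<open>\<rho>\<close> be the linear functional with
  \<open>\<rho> (H e) = 1\<close>, so that \<open>\<rho> < 1\<close> on the core. The decay of \<open>F\<close> on \<open>\<rho> \<ge> 1\<close> bounds the moment of the positive part of
  \<open>\<rho>\<close> by twice the mass \<open>m\<close> of the strip \<open>0 < \<rho> < 1\<close>. On the other hand, contraction towards
  \<open>z = - G e\<close>, where \<open>F\<close> is comparable with its supremum, moves a fixed fraction of \<open>m\<close> to points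
  where \<open>\<rho> \<le> (1 - G / H) / 2\<close>. If \<open>G / H\<close> is large, the negative part of \<open>\<rho>\<close> has a larger moment than
  the positive part, although the mean of \<open>\<rho>\<close> is \<open>0\<close>.
\<close>
lemma core_symmetric:
  assumes H: "0 < H" "H *\<^sub>R e \<notin> core" and G: "(- G) *\<^sub>R e \<in> core"
  shows "G \<le> 2^19 * H"
proof (rule ccontr)
  assume large: "\<not> G \<le> 2^19 * H"
  obtain a b where ab: "a \<bullet> (H *\<^sub>R e) < b" "\<And>p. p \<in> core \<Longrightarrow> b < a \<bullet> p"
    using separating_hyperplane_closed_point[OF core(1,2) H(2)] by blast
  have "b < 0" using ab(2)[OF core(3)] by simp
  define \<eta> where "\<eta> = a \<bullet> (H *\<^sub>R e)"
  have \<eta>: "\<eta> < 0" using ab(1) \<open>b < 0\<close> by (simp add: \<eta>_def)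
  define a' where "a' = (1 / \<eta>) *\<^sub>R a"
  have \<rho>: "0 + a' \<bullet> p = (a \<bullet> p) / \<eta>" for p by (simp add: a'_def)
  have out: "p \<notin> core" if "1 \<le> 0 + a' \<bullet> p" for p
  proof
    assume "p \<in> core"
    then have "\<eta> < a \<bullet> p" using ab(1) ab(2)[of p] unfolding \<eta>_def by linarith
    then show False using that \<eta> unfolding \<rho> by (simp add: field_simps)
  qed
  have "a \<noteq> 0" using \<eta> by (auto simp: \<eta>_def)
  then have "a' \<noteq> 0" using \<eta> by (simp add: a'_def)
  let ?J = "moment 0 a' {1..}" and ?I = "moment 0 a' {0<..<1}" and ?I2 = "moment 0 a' {1/2..<1}"
  have "?J \<le> 8 * (1/16) * moment 0 a' {x. 2 * x \<in> {1..}}"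
    by (rule moment_contraction[where z = 0]) (simp, simp, simp, intro outside_core out, simp only: atLeast_iff)
  also have "{x::real. 2 * x \<in> {1..}} = {1/2..<1} \<union> {1..}" by auto
  also have "moment 0 a' \<dots> = ?I2 + ?J" by (rule moment_Un) auto
  finally have J: "?J \<le> ?I2" by simp
  have "moment 0 a' ({0<..<1/2} \<union> {1/2..<1}) = moment 0 a' {0<..<1/2} + ?I2" by (rule moment_Un) auto
  moreover have "{0<..<1/2} \<union> {1/2..<1} = {0<..<1::real}" by auto
  ultimately have "?I = moment 0 a' {0<..<1/2} + ?I2" by simp
  moreover have "0 \<le> moment 0 a' {0<..<1/2}" by (rule moment_nonneg) auto
  ultimately have I2: "?I2 \<le> ?I" by linarith
  have "moment 0 a' ({0<..<1} \<union> {1..}) = ?I + ?J" by (rule moment_Un) auto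
  moreover have "{0<..<1} \<union> {1..} = {0::real<..}" by auto
  ultimately have "moment 0 a' {0<..} = ?I + ?J" by simp
  then have plus: "moment 0 a' {0<..} \<le> 2 * ?I" using J I2 by linarith
  define S where "S = (\<lambda>p. indicator {0<..<1} (0 + a' \<bullet> p) :: real)"
  have S_growth: "\<bar>S p\<bar> \<le> 1 + 0 * norm p" for p by (simp add: S_def indicator_def)
  have [measurable]: "S \<in> borel_measurable borel" unfolding S_def by measurable
  define m where "m = (\<integral>p. S p * F p \<partial>lborel)"
  have Im: "?I \<le> m" unfolding moment_def m_def
  proof (rule integral_mono)
    show "integrable lborel (\<lambda>p. S p * F p)" by (rule integrable_weighted[OF _ S_growth]) auto
    show "indicator {0<..<1} (0 + a' \<bullet> p) * (0 + a' \<bullet> p) * F p \<le> S p * F p" for p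
      by (rule mult_right_mono[OF _ nonneg]) (auto simp: S_def indicator_def)
  qed (rule integrable_moment, simp)
  let ?z = "(- G) *\<^sub>R e"
  have \<rho>z: "0 + a' \<bullet> ?z = - G / H"
  proof -
    have "\<eta> = H * (a \<bullet> e)" by (simp add: \<eta>_def)
    then have "a \<bullet> e \<noteq> 0" using \<eta> by auto
    then show ?thesis using \<open>\<eta> = H * (a \<bullet> e)\<close> H(1) unfolding \<rho> by (simp add: field_simps)
  qed
  have m: "m \<le> 4 * 2^13 * (\<integral>p. S (2 *\<^sub>R p - ?z) * F p \<partial>lborel)" unfolding m_def
  proof (rule contraction[OF _ S_growth])
    fix p
    have "F 0 \<le> 2^8 * F ?z" using G by (simp add: core_def divide_le_eq mult.commute)
    then have "2^17 * F 0 \<le> 2^17 * (2^8 * F ?z)" by (rule mult_left_mono) simp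
    \<comment> \<open>The exponent is raised to an even one, so that \<open>decay\<close> has an exact square root.\<close>
    then have "F p \<le> 2^17 * (2^8 * F ?z)" by (rule order_trans[OF centroid_value])
    also have "\<dots> = 2^25 * F ?z" by simp
    also have "\<dots> \<le> (2^13)\<^sup>2 * F ?z" by (rule mult_right_mono) (simp_all add: nonneg)
    finally show "F p \<le> 2^13 * F (midpoint p ?z)" by (rule decay) simp
  qed (auto simp: S_def)
  have "2^17 * (\<integral>p. S (2 *\<^sub>R p - ?z) * F p \<partial>lborel) = (\<integral>p. 2^17 * (S (2 *\<^sub>R p - ?z) * F p) \<partial>lborel)"
    by simp
  also have "\<dots> \<le> (\<integral>p. (indicator {0<..} (0 + a' \<bullet> p) * (0 + a' \<bullet> p)) * F p - (0 + a' \<bullet> p) * F p \<partial>lborel)"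
  proof (rule integral_mono')
    show "integrable lborel (\<lambda>p. (indicator {0<..} (0 + a' \<bullet> p) * (0 + a' \<bullet> p)) * F p - (0 + a' \<bullet> p) * F p)"
      by (rule Bochner_Integration.integrable_diff[OF integrable_moment integrable_affine]) simp
    fix p
    let ?\<rho> = "0 + a' \<bullet> p"
    have D: "0 + a' \<bullet> (2 *\<^sub>R p - ?z) = 2 * ?\<rho> + G / H"
    proof -
      have "0 + a' \<bullet> (2 *\<^sub>R p - q) = 2 * ?\<rho> - (0 + a' \<bullet> q)" for q by (simp add: inner_diff_right)
      from this[of ?z] show ?thesis unfolding \<rho>z by simp
    qed
    have "2^19 < G / H" using large H(1) by (simp add: field_simps)
    have "2^17 \<le> - ?\<rho>" if "2 * ?\<rho> + G / H < 1"
    proof -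
      have "2 * ?\<rho> < 1 - 2^19" using that \<open>2^19 < G / H\<close> by linarith
      also have "\<dots> \<le> 2 * (- (2^17))" by simp
      finally have "?\<rho> < - (2^17)" by (rule mult_left_less_imp_less) simp
      then show ?thesis by linarith
    qed
    then have le: "2^17 * S (2 *\<^sub>R p - ?z) \<le> indicator {0<..} ?\<rho> * ?\<rho> - ?\<rho>"
      unfolding S_def D by (force simp: indicator_def)
    then have "(2^17 * S (2 *\<^sub>R p - ?z)) * F p \<le> (indicator {0<..} ?\<rho> * ?\<rho> - ?\<rho>) * F p"
      using nonneg by (rule mult_right_mono)
    then show "2^17 * (S (2 *\<^sub>R p - ?z) * F p) \<le> (indicator {0<..} ?\<rho> * ?\<rho>) * F p - ?\<rho> * F p"
      by (simp only: left_diff_distrib mult.assoc)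
    have "0 \<le> (indicator {0<..} ?\<rho> * ?\<rho> - ?\<rho>) * F p"
      using nonneg[of p] by (intro mult_nonneg_nonneg) (auto simp: indicator_def)
    then show "0 \<le> (indicator {0<..} ?\<rho> * ?\<rho>) * F p - ?\<rho> * F p"
      by (simp only: left_diff_distrib)
  qed
  also have "\<dots> = moment 0 a' {0<..} - 0 * (\<integral>p. F p \<partial>lborel)"
    unfolding integral_affine[symmetric, of 0 a'] moment_def
    by (rule Bochner_Integration.integral_diff[OF integrable_moment integrable_affine]) simp
  finally have W: "4 * (4 * 2^13 * (\<integral>p. S (2 *\<^sub>R p - ?z) * F p \<partial>lborel)) \<le> moment 0 a' {0<..}" by simp
  have "4 * m \<le> 4 * (4 * 2^13 * (\<integral>p. S (2 *\<^sub>R p - ?z) * F p \<partial>lborel))" using m by (rule mult_left_mono) simp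
  then have "4 * m \<le> moment 0 a' {0<..}" using W by (rule order_trans)
  then show False using plus Im positive_part[OF \<open>a' \<noteq> 0\<close>] by linarith
qed

text \<open>
  The core meets the ray in a nondegenerate segment: it is compact, convex and a neighbourhood of the
  origin.
\<close>
lemma core_extent:
  assumes "e \<noteq> 0"
  obtains h where "0 < h" "\<And>t. 0 \<le> t \<Longrightarrow> t \<le> h \<Longrightarrow> t *\<^sub>R e \<in> core" "\<And>t. h < t \<Longrightarrow> t *\<^sub>R e \<notin> core"
proof -
  let ?S = "{t. t *\<^sub>R e \<in> core}"
  have "core \<subseteq> {p. F p \<noteq> 0}" using centroid_pos by (auto simp: core_def)
  then obtain R where R: "\<And>p. p \<in> core \<Longrightarrow> norm p \<le> R"
    using bounded_subset[OF bounded_support] unfolding bounded_iff by blast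
  have "t \<le> R / norm e" if "t \<in> ?S" for t
  proof -
    have "\<bar>t\<bar> * norm e \<le> R" using R[of "t *\<^sub>R e"] that by simp
    then have "\<bar>t\<bar> \<le> R / norm e" using assms by (simp add: field_simps)
    then show ?thesis by linarith
  qed
  then have bdd: "bdd_above ?S" by (rule bdd_above.I)
  have "closed ?S" using continuous_closed_vimage[OF core(2), of "\<lambda>t. t *\<^sub>R e"]
    by (simp add: vimage_def)
  then have h: "Sup ?S \<in> ?S" using core(3) bdd by (intro closed_contains_Sup) (auto intro!: exI[of _ 0])
  obtain r where r: "0 < r" "cball 0 r \<subseteq> core"
    using centroid_interior_core by (meson mem_interior_cball)
  have "(r / norm e) *\<^sub>R e \<in> cball 0 r" using r(1) assms by simp
  then have "r / norm e \<in> ?S" using r(2) by blast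
  then have "r / norm e \<le> Sup ?S" using bdd by (rule cSup_upper)
  then have pos: "0 < Sup ?S" using r(1) assms by (meson divide_pos_pos less_le_trans zero_less_norm_iff)
  show ?thesis
  proof (rule that[OF pos])
    fix t assume t: "0 \<le> t" "t \<le> Sup ?S"
    have "(1 - t / Sup ?S) *\<^sub>R 0 + (t / Sup ?S) *\<^sub>R (Sup ?S *\<^sub>R e) \<in> core"
      using core(1,3) h t pos by (intro convexD) (auto simp: field_simps)
    then show "t *\<^sub>R e \<in> core" using pos by simp
  next
    fix t assume "Sup ?S < t"
    then show "t *\<^sub>R e \<notin> core" using cSup_upper[OF _ bdd, of t] by auto
  qed
qed

lemma integrable_ray:
  assumes "e \<noteq> 0" "A \<in> sets borel"
  shows "integrable lborel (\<lambda>t. indicator A t * F (t *\<^sub>R e))"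
proof -
  obtain R where R: "\<And>p. F p \<noteq> 0 \<Longrightarrow> norm p \<le> R"
    using bounded_support by (auto simp: bounded_iff)
  have [measurable]: "A \<in> sets borel" by fact
  show ?thesis
  proof (rule Bochner_Integration.integrable_bound)
    show "integrable lborel (\<lambda>t. (2^17 * F 0) * indicator (cball (0::real) (R / norm e)) t)"
      by (intro integrable_mult_right integrable_real_indicator)
         (use emeasure_bounded_finite[OF bounded_cball] in \<open>auto simp: less_top simp del: cball_eq_atLeastAtMost\<close>)
    show "AE t in lborel. norm (indicator A t * F (t *\<^sub>R e)) \<le> norm (2^17 * F 0 * indicator (cball (0::real) (R / norm e)) t)"
    proof (rule AE_I2)
      fix t
      show "norm (indicator A t * F (t *\<^sub>R e)) \<le> norm (2^17 * F 0 * indicator (cball (0::real) (R / norm e)) t)"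
      proof (cases "F (t *\<^sub>R e) = 0")
        case False
        then have "\<bar>t\<bar> * norm e \<le> R" using R[of "t *\<^sub>R e"] by simp
        then have "t \<in> cball 0 (R / norm e)" using assms(1) by (simp add: field_simps)
        then show ?thesis using centroid_value[of "t *\<^sub>R e"] nonneg[of "t *\<^sub>R e"]
          by (auto simp: indicator_def)
      qed simp
    qed
  qed measurable
qed

text \<open>
  On each ray \<open>F\<close> is comparable with \<open>F 0\<close> inside the core and decays outside, so its integral is
  comparable with \<open>F 0\<close> times the extent of the core. The extents in opposite directions are comparable
  by \<open>core_symmetric\<close>.
\<close>
theorem ray_integrals:
  assumes "e \<noteq> 0"
  shows "0 < (\<integral>t. indicator {0..} t * F (t *\<^sub>R e) \<partial>lborel)"
    and "(\<integral>t. indicator {0..} t * F (t *\<^sub>R (- e)) \<partial>lborel)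
      \<le> 2^45 * (\<integral>t. indicator {0..} t * F (t *\<^sub>R e) \<partial>lborel)"
proof -
  obtain h where h: "0 < h" "\<And>t. 0 \<le> t \<Longrightarrow> t \<le> h \<Longrightarrow> t *\<^sub>R e \<in> core" "\<And>t. h < t \<Longrightarrow> t *\<^sub>R e \<notin> core"
    using core_extent[OF assms] by blast
  obtain g where g: "0 < g" "\<And>t. 0 \<le> t \<Longrightarrow> t \<le> g \<Longrightarrow> t *\<^sub>R (- e) \<in> core" "\<And>t. g < t \<Longrightarrow> t *\<^sub>R (- e) \<notin> core"
    using core_extent[of "- e"] assms by auto
  have gh: "g \<le> 2^19 * h"
  proof (rule ccontr)
    assume "\<not> ?thesis"
    then have "h < g / 2^19" by simp
    then obtain H where H: "h < H" "H < g / 2^19" using dense by blast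
    have "g \<le> 2^19 * H"
      using H h(1) g(1) h(3)[OF H(1)] g(2)[of g] by (intro core_symmetric[where e = e]) auto
    then show False using H(2) by simp
  qed
  let ?a = "\<integral>t. indicator {0..} t * F (t *\<^sub>R e) \<partial>lborel"
  let ?f = "\<lambda>t. F (t *\<^sub>R (- e))"
  let ?i = "\<lambda>A. \<integral>t. indicator A t * ?f t \<partial>lborel"
  have int: "integrable lborel (\<lambda>t. indicator A t * ?f t)" if "A \<in> sets borel" for A
    using integrable_ray[of "- e" A] assms that by simp
  have a: "F 0 / 2^8 * h \<le> ?a"
  proof -
    have "(\<integral>t. (F 0 / 2^8) * indicator {0..h} t \<partial>lborel) \<le> ?a"
    proof (rule integral_mono)
      show "integrable lborel (\<lambda>t. (F 0 / 2^8) * indicator {0..h} t)"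
        using h(1) by (intro integrable_mult_right integrable_real_indicator) auto
      show "F 0 / 2^8 * indicator {0..h} t \<le> indicator {0..} t * F (t *\<^sub>R e)" for t
        using h(2)[of t] nonneg by (auto simp: indicator_def core_def)
    qed (use assms in \<open>auto intro: integrable_ray\<close>)
    then show ?thesis using h(1) by simp
  qed
  then show "0 < ?a" using centroid_pos h(1) by (smt (verit) divide_pos_pos mult_pos_pos zero_less_power)
  have inner: "?i {0..g} \<le> 2^17 * F 0 * g"
  proof -
    have "?i {0..g} \<le> (\<integral>t. (2^17 * F 0) * indicator {0..g} t \<partial>lborel)"
    proof (rule integral_mono)
      show "integrable lborel (\<lambda>t. (2^17 * F 0) * indicator {0..g} t)"
        using g(1) by (intro integrable_mult_right integrable_real_indicator) auto
      show "indicator {0..g} t * ?f t \<le> 2^17 * F 0 * indicator {0..g} t" for t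
        using centroid_value by (auto simp: indicator_def)
    qed (rule int, simp)
    then show ?thesis using g(1) by simp
  qed
  have outer: "?i {g<..} \<le> 1/8 * ?i {0..}"
  proof -
    have "?i {g<..} = 2 * (\<integral>t. indicator {g<..} (2 * t) * ?f (2 * t) \<partial>lborel)"
      using lborel_integral_real_affine[of 2 "\<lambda>t. indicator {g<..} t * ?f t" 0] by simp
    also have "(\<integral>t. indicator {g<..} (2 * t) * ?f (2 * t) \<partial>lborel)
        \<le> (\<integral>t. 1/16 * (indicator {0..} t * ?f t) \<partial>lborel)"
    proof (rule integral_mono')
      show "integrable lborel (\<lambda>t. 1/16 * (indicator {0..} t * ?f t))"
        by (intro integrable_mult_right int) auto
      fix t
      have "midpoint ((2 * t) *\<^sub>R (- e)) 0 = t *\<^sub>R (- e)" by (simp add: midpoint_def)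
      then have "?f (2 * t) \<le> 1/16 * ?f t" if "g < 2 * t"
        using outside_core[OF g(3)[OF that]] by simp
      then show "indicator {g<..} (2 * t) * ?f (2 * t) \<le> 1/16 * (indicator {0..} t * ?f t)"
        using g(1) nonneg by (auto simp: indicator_def)
      show "0 \<le> 1/16 * (indicator {0..} t * ?f t)" using nonneg by simp
    qed
    finally show ?thesis by simp
  qed
  have split: "?i {0..} = ?i {0..g} + ?i {g<..}"
  proof -
    have "?i {0..} = (\<integral>t. indicator {0..g} t * ?f t + indicator {g<..} t * ?f t \<partial>lborel)"
      using g(1) by (intro Bochner_Integration.integral_cong refl) (auto simp: indicator_def)
    also have "\<dots> = ?i {0..g} + ?i {g<..}" by (rule Bochner_Integration.integral_add[OF int int]) simp_all
    finally show ?thesis .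
  qed
  have "0 \<le> ?i {g<..}" by (intro Bochner_Integration.integral_nonneg) (simp add: nonneg)
  moreover have "8 * ?i {g<..} \<le> ?i {0..}" using outer by simp
  ultimately have "?i {0..} \<le> 2 * ?i {0..g}" using split by linarith
  also have "\<dots> \<le> 2 * (2^17 * F 0 * g)" using inner by (rule mult_left_mono) simp
  also have "\<dots> = 2^18 * F 0 * g" by simp
  finally have "?i {0..} \<le> 2^18 * F 0 * g" .
  also have "\<dots> \<le> 2^18 * F 0 * (2^19 * h)" using gh centroid_pos by (intro mult_left_mono) auto
  also have "\<dots> = 2^45 * (F 0 / 2^8 * h)" by simp
  also have "\<dots> \<le> 2^45 * ?a" using a by (rule mult_left_mono) simp
  finally show "?i {0..} \<le> 2^45 * ?a" .
qed

end

section \<open>Orthogonal changes of variables\<close>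

interpretation lborel_product: product_sigma_finite "\<lambda>_::nat. lborel :: real measure" by standard

lemma space_lebesgue_on_points [simp]: "space (lebesgue_on_points n) = points n"
  by (simp add: lebesgue_on_points_def points_def space_PiM)

lemma sigma_finite_lebesgue_on_points: "sigma_finite_measure (lebesgue_on_points n)"
  unfolding lebesgue_on_points_def by (rule lborel_product.sigma_finite) simp

lemma measurable_coordinate [measurable]:
  "i < n \<Longrightarrow> (\<lambda>x. x i) \<in> borel_measurable (lebesgue_on_points n)"
  unfolding lebesgue_on_points_def
  using measurable_component_singleton[of i "{..<n}" "\<lambda>_. lborel :: real measure"] by simp

lemma measurable_into_points:
  assumes "\<And>i. i < n \<Longrightarrow> (\<lambda>x. g x i) \<in> borel_measurable N"
  shows "(\<lambda>x. \<lambda>i\<in>{..<n}. g x i) \<in> measurable N (lebesgue_on_points n)"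
  unfolding lebesgue_on_points_def by (rule measurable_restrict) (simp add: assms)

lemma emeasure_box:
  assumes "\<And>i. i < n \<Longrightarrow> A i \<in> sets borel"
  shows "emeasure (lebesgue_on_points n) (PiE {..<n} A) = (\<Prod>i<n. emeasure lborel (A i))"
  unfolding lebesgue_on_points_def by (rule lborel_product.emeasure_PiM) (auto simp: assms)

text \<open>
  The reflection is needed for the substitution of \<open>T x - y\<close> for \<open>y\<close> in \<open>nn_integral_orthogonal\<close>.
\<close>
lemma nn_integral_translate_reflect:
  assumes \<sigma>: "\<bar>\<sigma>\<bar> = 1" and f: "f \<in> borel_measurable (lebesgue_on_points n)"
  shows "(\<integral>\<^sup>+x. f (\<lambda>i\<in>{..<n}. a i + \<sigma> * x i) \<partial>lebesgue_on_points n) = (\<integral>\<^sup>+x. f x \<partial>lebesgue_on_points n)"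
proof -
  let ?M = "lebesgue_on_points n" and ?T = "\<lambda>x. \<lambda>i\<in>{..<n}. a i + \<sigma> * x i"
  have T [measurable]: "?T \<in> measurable ?M ?M"
    by (intro measurable_into_points borel_measurable_add borel_measurable_times measurable_coordinate) auto
  have line: "emeasure lborel {y. c + \<sigma> * y \<in> A} = emeasure lborel A" if [measurable]: "A \<in> sets borel" for c and A :: "real set"
  proof -
    have "emeasure lborel A = (\<integral>\<^sup>+y. indicator A y \<partial>lborel)" by simp
    also have "\<dots> = (\<integral>\<^sup>+y. indicator A (c + \<sigma> * y) \<partial>lborel)"
      using \<sigma> by (subst nn_integral_real_affine[where c = \<sigma> and t = c]) auto
    also have "\<dots> = (\<integral>\<^sup>+y. indicator {y. c + \<sigma> * y \<in> A} y \<partial>lborel)"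
      by (intro nn_integral_cong) (auto simp: indicator_def)
    finally show ?thesis by simp
  qed
  have "distr ?M ?M ?T = ?M"
    unfolding lebesgue_on_points_def
  proof (rule lborel_product.PiM_eqI)
    fix A :: "nat \<Rightarrow> real set" assume A: "\<And>i. i \<in> {..<n} \<Longrightarrow> A i \<in> sets lborel"
    then have A': "A i \<in> sets borel" if "i < n" for i using that by simp
    have B: "PiE {..<n} A \<in> sets ?M" unfolding lebesgue_on_points_def by (intro sets_PiM_I_finite) (auto simp: A')
    have "emeasure (distr ?M ?M ?T) (PiE {..<n} A) = emeasure ?M (?T -` (PiE {..<n} A) \<inter> points n)"
      by (subst emeasure_distr[OF T B]) simp
    also have "?T -` (PiE {..<n} A) \<inter> points n = (PiE {..<n} (\<lambda>i. {y. a i + \<sigma> * y \<in> A i}))"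
      by (rule set_eqI) (simp add: points_def PiE_iff Ball_def conj_commute cong: conj_cong)
    also have "emeasure ?M \<dots> = (\<Prod>i<n. emeasure lborel {y. a i + \<sigma> * y \<in> A i})"
    proof (rule emeasure_box)
      fix i assume "i < n"
      then show "{y. a i + \<sigma> * y \<in> A i} \<in> sets borel"
        using measurable_sets_borel[of "\<lambda>y. a i + \<sigma> * y" borel "A i"] A'[of i] by (simp add: vimage_def)
    qed
    also have "\<dots> = (\<Prod>i<n. emeasure lborel (A i))"
    proof (intro prod.cong refl line)
      fix i assume "i \<in> {..<n}" then show "A i \<in> sets borel" using A'[of i] by simp
    qed
    finally show "emeasure (distr (PiM {..<n} (\<lambda>_. lborel)) (PiM {..<n} (\<lambda>_. lborel)) ?T) (PiE {..<n} A)
        = (\<Prod>i<n. emeasure lborel (A i))" unfolding lebesgue_on_points_def .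
  qed auto
  then have "(\<integral>\<^sup>+x. f x \<partial>?M) = (\<integral>\<^sup>+x. f x \<partial>distr ?M ?M ?T)" by simp
  also have "\<dots> = (\<integral>\<^sup>+x. f (?T x) \<partial>?M)" by (rule nn_integral_distr[OF T]) (simp add: f)
  finally show ?thesis by simp
qed

text \<open>
  Orthonormal rows make orthonormal columns. By Bessel's equality the squared distance of the \<open>i\<close>-th standard
  basis vector to the span of the rows is \<open>1 - p i i\<close>, where \<open>p i i\<close> is the sum of the squares of the
  \<open>i\<close>-th column. These nonnegative numbers add up to \<open>n - n = 0\<close>, so all of them vanish.
\<close>
lemma transposed_orthonormal:
  fixes c :: "nat \<Rightarrow> nat \<Rightarrow> real"
  assumes orth: "\<And>j l. j < n \<Longrightarrow> l < n \<Longrightarrow> (\<Sum>k<n. c j k * c l k) = (if j = l then 1 else 0)"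
    and i: "i < n" and k: "k < n"
  shows "(\<Sum>j<n. c j i * c j k) = (if i = k then 1 else 0)"
proof -
  define p where "p i k = (\<Sum>j<n. c j i * c j k)" for i k
  define r where "r i k = (if i = k then 1 else 0) - p i k" for i k
  have pp: "(\<Sum>k<n. (p i k)\<^sup>2) = p i i" for i
  proof -
    have "(\<Sum>k<n. (p i k)\<^sup>2) = (\<Sum>k<n. \<Sum>j<n. \<Sum>l<n. (c j i * c l i) * (c j k * c l k))"
      unfolding p_def power2_eq_square sum_product by (simp only: mult_ac)
    also have "\<dots> = (\<Sum>j<n. \<Sum>k<n. \<Sum>l<n. (c j i * c l i) * (c j k * c l k))" by (rule sum.swap)
    also have "\<dots> = (\<Sum>j<n. \<Sum>l<n. \<Sum>k<n. (c j i * c l i) * (c j k * c l k))"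
      by (intro sum.cong refl sum.swap)
    also have "\<dots> = (\<Sum>j<n. \<Sum>l<n. if j = l then c j i * c l i else 0)"
      by (intro sum.cong refl) (simp add: orth flip: sum_distrib_left)
    also have "\<dots> = p i i" by (simp add: p_def)
    finally show ?thesis .
  qed
  have rr: "(\<Sum>k<n. (r i k)\<^sup>2) = 1 - p i i" if "i < n" for i
  proof -
    have "(r i k)\<^sup>2 = (if i = k then 1 - 2 * p i k else 0) + (p i k)\<^sup>2" for k
      by (simp add: r_def power2_eq_square algebra_simps)
    then have "(\<Sum>k<n. (r i k)\<^sup>2) = (\<Sum>k<n. if i = k then 1 - 2 * p i k else 0) + p i i"
      by (simp add: sum.distrib pp)
    then show ?thesis using that by simp
  qed
  have "(\<Sum>i<n. \<Sum>k<n. (r i k)\<^sup>2) = (\<Sum>i<n. 1 - p i i)" by (simp add: rr)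
  also have "\<dots> = real n - (\<Sum>i<n. \<Sum>j<n. c j i * c j i)" by (simp add: sum_subtractf p_def)
  also have "(\<Sum>i<n. \<Sum>j<n. c j i * c j i) = (\<Sum>j<n. \<Sum>i<n. c j i * c j i)" by (rule sum.swap)
  also have "\<dots> = real n" using orth by simp
  finally have "(\<Sum>i<n. \<Sum>k<n. (r i k)\<^sup>2) = 0" by simp
  then have "\<forall>i\<in>{..<n}. (\<Sum>k<n. (r i k)\<^sup>2) = 0" by (subst (asm) sum_nonneg_eq_0_iff) (auto intro: sum_nonneg)
  then have "\<forall>k\<in>{..<n}. (r i k)\<^sup>2 = 0" using i by (subst (asm) sum_nonneg_eq_0_iff) auto
  then show ?thesis using k by (simp add: r_def p_def split: if_splits)
qed

lemma orthonormal_expansion: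
  fixes c :: "nat \<Rightarrow> nat \<Rightarrow> real"
  assumes orth: "\<And>j l. j < n \<Longrightarrow> l < n \<Longrightarrow> (\<Sum>k<n. c j k * c l k) = (if j = l then 1 else 0)"
    and i: "i < n"
  shows "(\<Sum>j<n. (\<Sum>k<n. y k * c j k) * c j i) = y i"
proof -
  have "(\<Sum>j<n. (\<Sum>k<n. y k * c j k) * c j i) = (\<Sum>j<n. \<Sum>k<n. y k * (c j k * c j i))"
    by (simp only: sum_distrib_right mult.assoc)
  also have "\<dots> = (\<Sum>k<n. \<Sum>j<n. y k * (c j k * c j i))" by (rule sum.swap)
  also have "\<dots> = (\<Sum>k<n. if k = i then y k else 0)"
    using i by (intro sum.cong refl) (simp add: transposed_orthonormal[OF orth] flip: sum_distrib_left)
  also have "\<dots> = y i" using i by simp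
  finally show ?thesis .
qed

lemma ennreal_cancel_left: "a * x = a * y \<Longrightarrow> a \<noteq> 0 \<Longrightarrow> a \<noteq> \<infinity> \<Longrightarrow> x = y" for a x y :: ennreal
  by (simp add: ennreal_mult_cancel_left)

text \<open>
  The Euclidean unit ball is invariant under orthogonal maps and has finite nonzero measure; this makes
  it a test set that fixes the scaling constant of such a map to \<open>1\<close>.
\<close>
lemma unit_ball_measure:
  defines "B n \<equiv> {x \<in> points n. inner_prod n x x \<le> 1}"
  shows "B n \<in> sets (lebesgue_on_points n)" "emeasure (lebesgue_on_points n) (B n) \<noteq> 0"
    "emeasure (lebesgue_on_points n) (B n) \<noteq> \<infinity>"
proof -
  let ?M = "lebesgue_on_points n"
  have [measurable]: "(\<lambda>x. inner_prod n x x) \<in> borel_measurable ?M"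
    unfolding inner_prod_def by (intro borel_measurable_sum borel_measurable_times measurable_coordinate) auto
  have "{x \<in> space ?M. inner_prod n x x \<le> 1} \<in> sets ?M" by measurable
  then show sets: "B n \<in> sets ?M" by (simp add: B_def)
  define \<epsilon> where "\<epsilon> = 1 / (real n + 1)"
  have \<epsilon>: "0 < \<epsilon>" "\<epsilon> \<le> 1" "real n * \<epsilon> \<le> 1" by (auto simp: \<epsilon>_def field_simps)
  have "PiE {..<n} (\<lambda>_. {0..\<epsilon>}) \<subseteq> B n"
  proof
    fix x assume x: "x \<in> PiE {..<n} (\<lambda>_. {0..\<epsilon>})"
    have "inner_prod n x x \<le> (\<Sum>i<n. \<epsilon> * 1)" unfolding inner_prod_def
    proof (rule sum_mono)
      fix i assume "i \<in> {..<n}"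
      then have "0 \<le> x i" "x i \<le> \<epsilon>" using x by (auto simp: PiE_iff)
      then show "x i * x i \<le> \<epsilon> * 1" using \<epsilon> by (intro mult_mono) auto
    qed
    then have "inner_prod n x x \<le> 1" using \<epsilon>(3) by simp
    then show "x \<in> B n" using x by (auto simp: B_def points_def PiE_iff)
  qed
  then have "emeasure ?M (PiE {..<n} (\<lambda>_. {0..\<epsilon>})) \<le> emeasure ?M (B n)" using sets by (rule emeasure_mono)
  moreover have "emeasure ?M (PiE {..<n} (\<lambda>_. {0..\<epsilon>})) = ennreal (\<epsilon> ^ n)"
    using \<epsilon> by (simp add: emeasure_box ennreal_power)
  ultimately show "emeasure ?M (B n) \<noteq> 0" using \<epsilon> by auto
  have "B n \<subseteq> PiE {..<n} (\<lambda>_. {-1..1})"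
  proof
    fix x assume x: "x \<in> B n"
    have "x i \<in> {-1..1}" if "i < n" for i
    proof -
      have "x i * x i \<le> inner_prod n x x"
        unfolding inner_prod_def using that by (intro member_le_sum) auto
      then have "(x i)\<^sup>2 \<le> 1" using x by (simp add: B_def power2_eq_square)
      then have "\<bar>x i\<bar> \<le> 1" by (simp add: abs_square_le_1)
      then show ?thesis by (auto simp: abs_le_iff)
    qed
    then show "x \<in> PiE {..<n} (\<lambda>_. {-1..1})" using x by (auto simp: B_def points_def PiE_iff)
  qed
  then have "emeasure ?M (B n) \<le> emeasure ?M (PiE {..<n} (\<lambda>_. {-1..1}))"
    by (rule emeasure_mono) (auto simp: lebesgue_on_points_def intro!: sets_PiM_I_finite)
  also have "\<dots> = ennreal (2 ^ n)" by (simp add: emeasure_box flip: ennreal_power)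
  finally show "emeasure ?M (B n) \<noteq> \<infinity>" by (auto simp: top_unique)
qed

text \<open>
  Uniqueness of translation-invariant measures, in the form of a computation. Write \<open>T\<close> for the
  orthogonal map. In the double integral of \<open>f (T x) * g (T x + y)\<close>, integrating \<open>y\<close> first gives
  the integral of \<open>f \<circ> T\<close> times that of \<open>g\<close>. The shift of \<open>x\<close> by the preimage of \<open>y\<close> turns the
  integrand into \<open>f (T x - y) * g (T x)\<close>, and now integrating \<open>y\<close> first gives the integral of \<open>g \<circ> T\<close>
  times that of \<open>f\<close>. For \<open>g\<close> the indicator function of the unit ball, \<open>g \<circ> T = g\<close>, and this
  factor cancels.
\<close>
lemma nn_integral_orthogonal:
  fixes c :: "nat \<Rightarrow> nat \<Rightarrow> real"
  assumes orth: "\<And>j l. j < n \<Longrightarrow> l < n \<Longrightarrow> (\<Sum>k<n. c j k * c l k) = (if j = l then 1 else 0)"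
    and f: "f \<in> borel_measurable (lebesgue_on_points n)"
  shows "(\<integral>\<^sup>+x. f (\<lambda>i\<in>{..<n}. \<Sum>j<n. x j * c j i) \<partial>lebesgue_on_points n) = (\<integral>\<^sup>+x. f x \<partial>lebesgue_on_points n)"
proof -
  let ?M = "lebesgue_on_points n"
  define T where "T x = (\<lambda>i\<in>{..<n}. \<Sum>j<n. x j * c j i)" for x :: point
  define S where "S y = (\<lambda>j. \<Sum>i<n. y i * c j i)" for y :: point
  define B where "B = {x \<in> points n. inner_prod n x x \<le> 1}"
  interpret sigma_finite_measure ?M by (rule sigma_finite_lebesgue_on_points)
  interpret pair_sigma_finite ?M ?M by standard
  have T [measurable]: "T \<in> measurable ?M ?M"
    unfolding T_def by (intro measurable_into_points borel_measurable_sum borel_measurable_times measurable_coordinate) auto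
  have T_points: "T x \<in> points n" for x by (simp add: T_def points_def)
  have norm_T: "inner_prod n (T x) (T x) = inner_prod n x x" for x
  proof -
    have "inner_prod n (T x) (T x) = (\<Sum>i<n. \<Sum>j<n. \<Sum>l<n. (x j * x l) * (c j i * c l i))"
      unfolding inner_prod_def T_def by (intro sum.cong refl) (simp add: sum_product mult_ac)
    also have "\<dots> = (\<Sum>j<n. \<Sum>i<n. \<Sum>l<n. (x j * x l) * (c j i * c l i))" by (rule sum.swap)
    also have "\<dots> = (\<Sum>j<n. \<Sum>l<n. \<Sum>i<n. (x j * x l) * (c j i * c l i))" by (intro sum.cong refl sum.swap)
    also have "\<dots> = (\<Sum>j<n. \<Sum>l<n. if j = l then x j * x l else 0)"
      by (intro sum.cong refl) (simp add: orth flip: sum_distrib_left)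
    also have "\<dots> = inner_prod n x x" by (simp add: inner_prod_def)
    finally show ?thesis .
  qed
  have T_S: "(\<Sum>j<n. S y j * c j i) = y i" if "i < n" for y i
    unfolding S_def using orth that by (rule orthonormal_expansion)
  have swap: "(\<integral>\<^sup>+x. f (T x) \<partial>?M) * (\<integral>\<^sup>+x. g x \<partial>?M) = (\<integral>\<^sup>+x. g (T x) \<partial>?M) * (\<integral>\<^sup>+x. f x \<partial>?M)"
    if g: "g \<in> borel_measurable ?M" for g
  proof -
    note [measurable] = f g
    have pr: "(\<lambda>z. fst z i) \<in> borel_measurable (?M \<Otimes>\<^sub>M ?M)" "(\<lambda>z. snd z i) \<in> borel_measurable (?M \<Otimes>\<^sub>M ?M)" if "i < n" for i
      using that by measurable
    have [measurable]: "(\<lambda>z. \<lambda>i\<in>{..<n}. T (fst z) i + 1 * snd z i) \<in> measurable (?M \<Otimes>\<^sub>M ?M) ?M"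
        "(\<lambda>z. \<lambda>i\<in>{..<n}. T (fst z) i + (- 1) * snd z i) \<in> measurable (?M \<Otimes>\<^sub>M ?M) ?M"
      by (rule measurable_into_points, intro borel_measurable_add borel_measurable_times borel_measurable_const pr
          measurable_compose[OF measurable_compose[OF measurable_fst T] measurable_coordinate], assumption+)+
    have "(\<integral>\<^sup>+x. f (T x) \<partial>?M) * (\<integral>\<^sup>+y. g y \<partial>?M)
        = (\<integral>\<^sup>+x. f (T x) * (\<integral>\<^sup>+y. g y \<partial>?M) \<partial>?M)" by (simp add: nn_integral_multc)
    also have "\<dots> = (\<integral>\<^sup>+x. f (T x) * (\<integral>\<^sup>+y. g (\<lambda>i\<in>{..<n}. T x i + 1 * y i) \<partial>?M) \<partial>?M)"
      by (simp only: nn_integral_translate_reflect[OF _ g] abs_one)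
    also have "\<dots> = (\<integral>\<^sup>+x. \<integral>\<^sup>+y. f (T x) * g (\<lambda>i\<in>{..<n}. T x i + 1 * y i) \<partial>?M \<partial>?M)"
      by (intro nn_integral_cong nn_integral_cmult[symmetric] measurable_compose[OF _ g] measurable_into_points
          borel_measurable_add borel_measurable_times measurable_coordinate borel_measurable_const)
    also have "\<dots> = (\<integral>\<^sup>+y. \<integral>\<^sup>+x. f (T x) * g (\<lambda>i\<in>{..<n}. T x i + 1 * y i) \<partial>?M \<partial>?M)"
    proof (rule Fubini'[symmetric])
      have "(\<lambda>z. f (T (fst z)) * g (\<lambda>i\<in>{..<n}. T (fst z) i + 1 * snd z i)) \<in> borel_measurable (?M \<Otimes>\<^sub>M ?M)"
        by measurable
      then show "(\<lambda>(x, y). f (T x) * g (\<lambda>i\<in>{..<n}. T x i + 1 * y i)) \<in> borel_measurable (?M \<Otimes>\<^sub>M ?M)"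
        by (simp only: case_prod_beta')
    qed
    also have "\<dots> = (\<integral>\<^sup>+y. \<integral>\<^sup>+x. f (\<lambda>i\<in>{..<n}. T x i + (- 1) * y i) * g (T x) \<partial>?M \<partial>?M)"
    proof (rule nn_integral_cong)
      fix y assume "y \<in> space ?M"
      let ?f = "\<lambda>x. f (T x) * g (\<lambda>i\<in>{..<n}. T x i + 1 * y i)" and ?shift = "\<lambda>x. \<lambda>i\<in>{..<n}. - S y i + 1 * x i"
      have "?f \<in> borel_measurable ?M"
      proof (intro borel_measurable_times_ennreal measurable_compose[OF T f] measurable_compose[OF _ g])
        show "(\<lambda>x. \<lambda>i\<in>{..<n}. T x i + 1 * y i) \<in> measurable ?M ?M"
          by (intro measurable_into_points borel_measurable_add borel_measurable_const
            measurable_compose[OF T measurable_coordinate])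
      qed
      from nn_integral_translate_reflect[OF _ this, of 1 "\<lambda>i. - S y i"]
      have "(\<integral>\<^sup>+x. ?f x \<partial>?M) = (\<integral>\<^sup>+x. ?f (?shift x) \<partial>?M)" by simp
      also have "\<dots> = (\<integral>\<^sup>+x. f (\<lambda>i\<in>{..<n}. T x i + (- 1) * y i) * g (T x) \<partial>?M)"
      proof (intro nn_integral_cong)
        fix x assume "x \<in> space ?M"
        have 1: "T (?shift x) = (\<lambda>i\<in>{..<n}. T x i + (- 1) * y i)"
        proof (rule ext)
          fix i
          show "T (?shift x) i = (\<lambda>i\<in>{..<n}. T x i + (- 1) * y i) i"
          proof (cases "i < n")
            case True
            then have "T (?shift x) i = (\<Sum>j<n. x j * c j i - S y j * c j i)"
              by (simp add: T_def algebra_simps)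
            also have "\<dots> = T x i - y i" using True by (simp add: sum_subtractf T_S) (simp add: T_def)
            finally show ?thesis using True by simp
          qed (simp add: T_def)
        qed
        have "(\<lambda>i\<in>{..<n}. T (?shift x) i + 1 * y i) = T x"
          unfolding 1 using T_points[of x] by (auto simp: fun_eq_iff points_def PiE_iff extensional_def)
        then show "?f (?shift x) = f (\<lambda>i\<in>{..<n}. T x i + (- 1) * y i) * g (T x)" unfolding 1 by simp
      qed
      finally show "(\<integral>\<^sup>+x. ?f x \<partial>?M) = (\<integral>\<^sup>+x. f (\<lambda>i\<in>{..<n}. T x i + (- 1) * y i) * g (T x) \<partial>?M)" .
    qed
    also have "\<dots> = (\<integral>\<^sup>+x. \<integral>\<^sup>+y. f (\<lambda>i\<in>{..<n}. T x i + (- 1) * y i) * g (T x) \<partial>?M \<partial>?M)"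
    proof (rule Fubini')
      have "(\<lambda>z. f (\<lambda>i\<in>{..<n}. T (fst z) i + (- 1) * snd z i) * g (T (fst z))) \<in> borel_measurable (?M \<Otimes>\<^sub>M ?M)"
        by measurable
      then show "(\<lambda>(x, y). f (\<lambda>i\<in>{..<n}. T x i + (- 1) * y i) * g (T x)) \<in> borel_measurable (?M \<Otimes>\<^sub>M ?M)"
        by (simp only: case_prod_beta')
    qed
    also have "\<dots> = (\<integral>\<^sup>+x. (\<integral>\<^sup>+y. f (\<lambda>i\<in>{..<n}. T x i + (- 1) * y i) \<partial>?M) * g (T x) \<partial>?M)"
      by (intro nn_integral_cong nn_integral_multc measurable_compose[OF _ f] measurable_into_points
          borel_measurable_add borel_measurable_times measurable_coordinate borel_measurable_const)
    also have "\<dots> = (\<integral>\<^sup>+x. (\<integral>\<^sup>+y. f y \<partial>?M) * g (T x) \<partial>?M)"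
      by (simp only: nn_integral_translate_reflect[OF _ f] abs_minus_cancel abs_one)
    also have "\<dots> = (\<integral>\<^sup>+x. f x \<partial>?M) * (\<integral>\<^sup>+x. g (T x) \<partial>?M)" by (simp add: nn_integral_cmult)
    finally show ?thesis by (simp only: mult.commute)
  qed
  note [measurable] = unit_ball_measure(1)[of n, folded B_def]
  have BT: "indicator B (T x) = (indicator B x :: ennreal)" if "x \<in> space ?M" for x
    using that T_points[of x] by (auto simp: B_def norm_T indicator_def)
  have "(\<integral>\<^sup>+x. indicator B (T x) \<partial>?M) = (\<integral>\<^sup>+x. indicator B x \<partial>?M)" by (intro nn_integral_cong BT)
  also have "\<dots> = emeasure ?M B" by simp
  finally have "(\<integral>\<^sup>+x. f (T x) \<partial>?M) * emeasure ?M B = emeasure ?M B * (\<integral>\<^sup>+x. f x \<partial>?M)"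
    using swap[of "indicator B"] by simp
  then have "emeasure ?M B * (\<integral>\<^sup>+x. f (T x) \<partial>?M) = emeasure ?M B * (\<integral>\<^sup>+x. f x \<partial>?M)" by (simp only: mult.commute)
  then have "(\<integral>\<^sup>+x. f (T x) \<partial>?M) = (\<integral>\<^sup>+x. f x \<partial>?M)"
    by (rule ennreal_cancel_left[OF _ unit_ball_measure(2,3)[of n, folded B_def]])
  then show ?thesis unfolding T_def .
qed

section \<open>Integration along a hyperplane\<close>

definition hyperplane_point :: "nat \<Rightarrow> point \<Rightarrow> (nat \<Rightarrow> point) \<Rightarrow> real \<Rightarrow> point \<Rightarrow> point" where
  "hyperplane_point m u b s t = (\<lambda>i\<in>{..<Suc m}. s * u i + (\<Sum>j<m. t j * b j i))"

lemma inner_prod_commute: "inner_prod n x y = inner_prod n y x"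
  by (simp add: inner_prod_def mult.commute)

lemma hyperplane_frame_orthonormal:
  assumes u: "u \<in> unit_sphere (Suc m)" and b: "hyperplane_basis (Suc m) u b"
    and "j < Suc m" "l < Suc m"
  shows "(\<Sum>k<Suc m. (if j < m then b j k else u k) * (if l < m then b l k else u k)) = (if j = l then 1 else 0)"
proof -
  have bu: "inner_prod (Suc m) (b j) u = 0" "inner_prod (Suc m) u (b j) = 0" if "j < m" for j
    using b that by (auto simp: hyperplane_basis_def inner_prod_commute[of _ u])
  have bb: "inner_prod (Suc m) (b j) (b l) = (if j = l then 1 else 0)" if "j < m" "l < m" for j l
    using b that by (simp add: hyperplane_basis_def)
  have uu: "inner_prod (Suc m) u u = 1" using u by (simp add: unit_sphere_def)
  show ?thesis
    using bu bb uu assms(3,4) unfolding inner_prod_def by (cases "j < m"; cases "l < m") (simp_all del: sum.lessThan_Suc)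
qed

lemma inner_prod_hyperplane_point:
  "inner_prod (Suc m) (hyperplane_point m u b s t) y
    = s * inner_prod (Suc m) u y + (\<Sum>j<m. t j * inner_prod (Suc m) (b j) y)"
proof -
  have "inner_prod (Suc m) (hyperplane_point m u b s t) y
      = (\<Sum>i<Suc m. s * (u i * y i) + (\<Sum>j<m. t j * (b j i * y i)))"
    unfolding inner_prod_def hyperplane_point_def
    by (intro sum.cong refl) (simp add: distrib_right sum_distrib_right mult.assoc)
  also have "\<dots> = s * (\<Sum>i<Suc m. u i * y i) + (\<Sum>i<Suc m. \<Sum>j<m. t j * (b j i * y i))"
    by (simp only: sum.distrib sum_distrib_left)
  also have "(\<Sum>i<Suc m. \<Sum>j<m. t j * (b j i * y i)) = (\<Sum>j<m. \<Sum>i<Suc m. t j * (b j i * y i))" by (rule sum.swap)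
  finally show ?thesis unfolding inner_prod_def by (simp only: sum_distrib_left)
qed

lemma inner_prod_hyperplane_coordinates:
  assumes u: "u \<in> unit_sphere (Suc m)" and b: "hyperplane_basis (Suc m) u b"
  shows "inner_prod (Suc m) (hyperplane_point m u b s t) u = s"
    and "j < m \<Longrightarrow> inner_prod (Suc m) (hyperplane_point m u b s t) (b j) = t j"
    and "inner_prod (Suc m) (hyperplane_point m u b s t) (hyperplane_point m u b s t) = s\<^sup>2 + inner_prod m t t"
proof -
  have uu: "inner_prod (Suc m) u u = 1" using u by (simp add: unit_sphere_def)
  have bu: "inner_prod (Suc m) (b j) u = 0" "inner_prod (Suc m) u (b j) = 0" if "j < m" for j
    using b that by (auto simp: hyperplane_basis_def inner_prod_commute[of _ u])
  have bb: "inner_prod (Suc m) (b j) (b l) = (if j = l then 1 else 0)" if "j < m" "l < m" for j l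
    using b that by (simp add: hyperplane_basis_def)
  let ?x = "hyperplane_point m u b s t"
  show 1: "inner_prod (Suc m) ?x u = s" by (simp add: inner_prod_hyperplane_point uu bu)
  have 2: "inner_prod (Suc m) ?x (b j) = t j" if "j < m" for j
  proof -
    have "inner_prod (Suc m) ?x (b j) = (\<Sum>l<m. if l = j then t l else 0)"
      unfolding inner_prod_hyperplane_point using that by (simp add: bu bb if_distrib cong: if_cong)
    then show ?thesis using that by simp
  qed
  then show "j < m \<Longrightarrow> inner_prod (Suc m) ?x (b j) = t j" .
  have "inner_prod (Suc m) ?x ?x = s * inner_prod (Suc m) ?x u + (\<Sum>j<m. t j * inner_prod (Suc m) ?x (b j))"
    by (subst inner_prod_hyperplane_point) (simp only: inner_prod_commute[of _ ?x])
  also have "\<dots> = s\<^sup>2 + inner_prod m t t" by (simp add: 1 2 power2_eq_square inner_prod_def[of m t t])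
  finally show "inner_prod (Suc m) ?x ?x = s\<^sup>2 + inner_prod m t t" .
qed

text \<open>
  A unit vector orthogonal to all of \<open>b\<close> is a multiple of \<open>u\<close>, hence equal to \<open>u\<close> or its
  negative.
\<close>
lemma hyperplane_coordinate_nonzero:
  assumes u: "u \<in> unit_sphere (Suc m)" and b: "hyperplane_basis (Suc m) u b"
    and v: "v \<in> unit_sphere (Suc m)" "v \<noteq> u" "v \<noteq> neg (Suc m) u"
  shows "\<exists>j<m. inner_prod (Suc m) (b j) v \<noteq> 0"
proof (rule ccontr)
  assume *: "\<not> ?thesis"
  let ?a = "inner_prod (Suc m) u v"
  have vi: "v i = ?a * u i" if "i < Suc m" for i
  proof -
    have "v i = (\<Sum>j<Suc m. (\<Sum>k<Suc m. v k * (if j < m then b j k else u k)) * (if j < m then b j i else u i))"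
      by (rule orthonormal_expansion[OF hyperplane_frame_orthonormal[OF u b] that, symmetric])
    also have "\<dots> = (\<Sum>j<m. inner_prod (Suc m) (b j) v * b j i) + ?a * u i"
      by (subst sum.lessThan_Suc) (simp add: inner_prod_def mult.commute del: sum.lessThan_Suc)
    also have "\<dots> = ?a * u i" using * by simp
    finally show ?thesis .
  qed
  have "inner_prod (Suc m) v v = (\<Sum>i<Suc m. ?a * ?a * (u i * u i))"
    unfolding inner_prod_def[of _ v v] by (intro sum.cong refl) (simp add: vi)
  also have "\<dots> = ?a * ?a * inner_prod (Suc m) u u" by (simp only: inner_prod_def[of _ u u] sum_distrib_left)
  finally have "?a * ?a = 1" using u v(1) by (simp add: unit_sphere_def)
  then have "?a = 1 \<or> ?a = - 1" by (simp add: square_eq_1_iff)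
  moreover have ext: "x = y" if "x \<in> points (Suc m)" "y \<in> points (Suc m)" "\<And>i. i < Suc m \<Longrightarrow> x i = y i" for x y
    using that unfolding points_def by (intro PiE_ext) auto
  have "v \<in> points (Suc m)" "u \<in> points (Suc m)" "neg (Suc m) u \<in> points (Suc m)"
    using u v(1) by (auto simp: unit_sphere_def neg_def points_def)
  ultimately show False using v(2,3) vi ext[of v u] ext[of v "neg (Suc m) u"] by (auto simp: neg_def)
qed

lemma hyperplane_point_measurable [measurable]:
  "(\<lambda>z. hyperplane_point m u b (fst z) (snd z)) \<in> measurable (borel \<Otimes>\<^sub>M lebesgue_on_points m) (lebesgue_on_points (Suc m))"
  unfolding hyperplane_point_def
proof (rule measurable_into_points)
  have "(\<lambda>z. snd z j) \<in> borel_measurable (borel \<Otimes>\<^sub>M lebesgue_on_points m)" if "j < m" for j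
    using measurable_compose[OF measurable_snd measurable_coordinate[OF that]] .
  then show "(\<lambda>z. fst z * u i + (\<Sum>j<m. snd z j * b j i)) \<in> borel_measurable (borel \<Otimes>\<^sub>M lebesgue_on_points m)" for i
    by (intro borel_measurable_add borel_measurable_times borel_measurable_sum borel_measurable_const measurable_fst) auto
qed

lemma hyperplane_point_in_points: "hyperplane_point m u b s t \<in> points (Suc m)"
  by (simp add: hyperplane_point_def points_def)

text \<open>
  Fubini's theorem along a hyperplane: the frame of \<open>b\<close> and \<open>u\<close> is orthonormal, and \<open>u\<close> takes the
  place of the last coordinate.
\<close>
lemma nn_integral_hyperplane:
  assumes u: "u \<in> unit_sphere (Suc m)" and b: "hyperplane_basis (Suc m) u b"
    and f: "f \<in> borel_measurable (lebesgue_on_points (Suc m))"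
  shows "(\<integral>\<^sup>+x. f x \<partial>lebesgue_on_points (Suc m))
    = (\<integral>\<^sup>+s. \<integral>\<^sup>+t. f (hyperplane_point m u b s t) \<partial>lebesgue_on_points m \<partial>lborel)"
proof -
  let ?c = "\<lambda>j k. if j < m then b j k else u k"
  let ?T = "\<lambda>x. \<lambda>i\<in>{..<Suc m}. \<Sum>j<Suc m. x j * ?c j i"
  have T: "?T \<in> measurable (lebesgue_on_points (Suc m)) (lebesgue_on_points (Suc m))"
    by (intro measurable_into_points borel_measurable_sum borel_measurable_times measurable_coordinate borel_measurable_const) simp
  have ins: "{..<Suc m} = insert m {..<m}" by auto
  have "(\<integral>\<^sup>+x. f x \<partial>lebesgue_on_points (Suc m)) = (\<integral>\<^sup>+x. f (?T x) \<partial>lebesgue_on_points (Suc m))"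
    by (rule nn_integral_orthogonal[OF hyperplane_frame_orthonormal[OF u b] f, symmetric])
  also have "\<dots> = (\<integral>\<^sup>+x. f (?T x) \<partial>PiM (insert m {..<m}) (\<lambda>_. lborel))"
    by (simp only: lebesgue_on_points_def ins)
  also have "\<dots> = (\<integral>\<^sup>+s. \<integral>\<^sup>+t. f (?T (t(m := s))) \<partial>PiM {..<m} (\<lambda>_. lborel) \<partial>lborel)"
  proof (rule lborel_product.product_nn_integral_insert_rev)
    show "(\<lambda>x. f (?T x)) \<in> borel_measurable (PiM (insert m {..<m}) (\<lambda>_. lborel))"
      using measurable_compose[OF T f] by (simp only: lebesgue_on_points_def ins)
  qed auto
  finally have *: "(\<integral>\<^sup>+x. f x \<partial>lebesgue_on_points (Suc m))
      = (\<integral>\<^sup>+s. \<integral>\<^sup>+t. f (?T (t(m := s))) \<partial>PiM {..<m} (\<lambda>_. lborel) \<partial>lborel)" .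
  have "?T (t(m := s)) = hyperplane_point m u b s t" for s t
    unfolding hyperplane_point_def by (rule restrict_ext) (subst sum.lessThan_Suc, simp)
  then show ?thesis unfolding * by (simp only: lebesgue_on_points_def[of m])
qed


section \<open>Measurability and volume of convex bodies\<close>

text \<open>
  The type \<open>nat \<Rightarrow> real\<close> carries the product topology over all indices. On the points of
  the \<open>n\<close>-dimensional space the further coordinates are constant, so nothing is lost by passing to this
  topology.
\<close>
lemma compact_points:
  assumes K: "K \<subseteq> points n" "compactin (topology_on_points n) K"
  shows "compact K"
proof -
  have "continuous_map (topology_on_points n) (product_topology (\<lambda>_. euclideanreal) UNIV) (\<lambda>x. x)"
    unfolding continuous_map_componentwise_UNIV
  proof
    fix k
    show "continuous_map (topology_on_points n) euclideanreal (\<lambda>x. x k)"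
    proof (cases "k < n")
      case True
      then show ?thesis unfolding topology_on_points_def by (intro continuous_map_product_projection) auto
    next
      case False
      have "continuous_map (topology_on_points n) euclideanreal (\<lambda>x. undefined)" by simp
      then show ?thesis
        by (rule continuous_map_eq) (use False in \<open>auto simp: topology_on_points_def PiE_iff extensional_def\<close>)
    qed
  qed
  from image_compactin[OF K(2) this] show ?thesis
    by (simp add: euclidean_product_topology)
qed

lemma closed_in_sets:
  assumes "closed K" "K \<subseteq> points n"
  shows "K \<in> sets (lebesgue_on_points n)"
proof -
  have "(\<lambda>x. \<lambda>i. x i) \<in> measurable (lebesgue_on_points n) (PiM UNIV (\<lambda>_. borel :: real measure))"
  proof (rule measurable_PiM_single')
    fix i :: nat
    show "(\<lambda>x. x i) \<in> borel_measurable (lebesgue_on_points n)"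
    proof (cases "i < n")
      case False
      have "(\<lambda>x. x i) \<in> borel_measurable (lebesgue_on_points n) \<longleftrightarrow> (\<lambda>x. undefined :: real) \<in> borel_measurable (lebesgue_on_points n)"
        by (rule measurable_cong) (use False in \<open>auto simp: points_def PiE_iff extensional_def\<close>)
      then show ?thesis by simp
    qed (rule measurable_coordinate)
  qed auto
  moreover have "K \<in> sets (PiM UNIV (\<lambda>_. borel :: real measure))"
    using assms(1) by (simp add: sets_PiM_equal_borel)
  ultimately have "(\<lambda>x. x) -` K \<inter> space (lebesgue_on_points n) \<in> sets (lebesgue_on_points n)"
    by (rule measurable_sets)
  then show ?thesis using assms(2) by (simp add: Int_absorb2)
qed

lemma compact_norm_bound:
  assumes "compact K" 
  shows "\<exists>R\<ge>0. \<forall>x\<in>K. inner_prod n x x \<le> R\<^sup>2"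
proof -
  have "continuous_on K (\<lambda>x. inner_prod n x x)" unfolding inner_prod_def
    by (intro continuous_intros continuous_on_subset[OF continuous_on_product_coordinates]) auto
  then have "bounded ((\<lambda>x. inner_prod n x x) ` K)"
    using assms by (intro compact_imp_bounded compact_continuous_image)
  then obtain B where B: "\<And>x. x \<in> K \<Longrightarrow> inner_prod n x x \<le> B"
    by (force simp: bounded_real abs_le_iff)
  have "inner_prod n x x \<le> (\<bar>B\<bar> + 1)\<^sup>2" if "x \<in> K" for x
  proof -
    have "B \<le> \<bar>B\<bar> + 1" by simp
    also have "\<dots> \<le> (\<bar>B\<bar> + 1)\<^sup>2" by (rule self_le_power) auto
    finally show ?thesis using B[OF that] by linarith
  qed
  then show ?thesis by (intro exI[of _ "\<bar>B\<bar> + 1"]) auto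
qed

definition cube :: "nat \<Rightarrow> real \<Rightarrow> point set" where
  "cube n R = PiE {..<n} (\<lambda>_. {-R..R})"

lemma cube_measure: "cube n R \<in> sets (lebesgue_on_points n)" "emeasure (lebesgue_on_points n) (cube n R) \<noteq> \<infinity>"
proof -
  show "cube n R \<in> sets (lebesgue_on_points n)"
    unfolding cube_def lebesgue_on_points_def by (intro sets_PiM_I_finite) auto
  have "emeasure (lebesgue_on_points n) (cube n R) = emeasure lborel {-R..R} ^ n"
    unfolding cube_def by (subst emeasure_box) auto
  also have "\<dots> < \<infinity>" by (simp add: emeasure_lborel_Icc_eq power_less_top_ennreal)
  finally show "emeasure (lebesgue_on_points n) (cube n R) \<noteq> \<infinity>" by simp
qed

lemma in_cube:
  assumes x: "x \<in> points n" and R: "0 \<le> R" "inner_prod n x x \<le> R\<^sup>2"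
  shows "x \<in> cube n R"
proof -
  have "x i \<in> {-R..R}" if "i < n" for i
  proof -
    have "x i * x i \<le> inner_prod n x x"
      unfolding inner_prod_def using that by (intro member_le_sum) auto
    then have "\<bar>x i\<bar>\<^sup>2 \<le> R\<^sup>2" using R(2) by (simp add: power2_eq_square)
    then have "\<bar>x i\<bar> \<le> R" using R(1) by (rule power2_le_imp_le)
    then show ?thesis by (auto simp: abs_le_iff)
  qed
  then show ?thesis using x by (auto simp: cube_def points_def PiE_iff)
qed

lemma interior_positive_measure:
  assumes K: "K \<in> sets (lebesgue_on_points n)" and int: "topology_on_points n interior_of K \<noteq> {}"
  shows "0 < emeasure (lebesgue_on_points n) K"
proof -
  obtain x where x: "x \<in> topology_on_points n interior_of K" using int by blast
  have "openin (product_topology (\<lambda>_. euclideanreal) {..<n}) (topology_on_points n interior_of K)"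
    by (simp add: topology_on_points_def)
  then obtain U where U: "\<And>i. i < n \<Longrightarrow> open (U i)" "x \<in> PiE {..<n} U" "PiE {..<n} U \<subseteq> topology_on_points n interior_of K"
    using x unfolding openin_product_topology_alt by (metis lessThan_iff open_openin)
  have U_borel: "U i \<in> sets borel" if "i < n" for i using U(1)[OF that] by simp
  have pos: "0 < emeasure lborel (U i)" if i: "i < n" for i
  proof -
    have "x i \<in> U i" using U(2) i by (auto simp: PiE_iff)
    then obtain e where e: "0 < e" "ball (x i) e \<subseteq> U i" using U(1)[OF i] by (meson open_contains_ball)
    have "0 < ennreal (2 * e)" using e(1) by simp
    also have "\<dots> = emeasure lborel {x i - e <..< x i + e}" using e(1) by simp
    also have "\<dots> \<le> emeasure lborel (U i)"
      using e(2) U_borel[OF i] by (intro emeasure_mono) (auto simp: ball_eq_greaterThanLessThan)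
    finally show ?thesis .
  qed
  have "0 < (\<Prod>i\<in>I. emeasure lborel (U i))" if "finite I" "I \<subseteq> {..<n}" for I
    using that
  proof (induction I rule: finite_induct)
    case (insert i I)
    then have "0 < emeasure lborel (U i)" "0 < (\<Prod>i\<in>I. emeasure lborel (U i))" using pos by auto
    then show ?case using insert.hyps by (simp add: ennreal_zero_less_mult_iff)
  qed simp
  from this[of "{..<n}"] have "0 < emeasure (lebesgue_on_points n) (PiE {..<n} U)"
    by (simp add: emeasure_box[OF U_borel])
  also have "\<dots> \<le> emeasure (lebesgue_on_points n) K"
    using order_trans[OF U(3) interior_of_subset] K by (rule emeasure_mono)
  finally show ?thesis .
qed



section \<open>Slices of codimension two\<close>

text \<open>
  The directions \<open>w\<close> and \<open>d\<close> are given by their coordinates in the basis \<open>b\<close> of the hyperplane, so the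
  hyperplane is again a space of points and can be sliced by the same lemma.
\<close>
locale sliced_body =
  fixes k :: nat and K :: "point set" and u w :: point and b d :: "nat \<Rightarrow> point"
  assumes body: "convex_body (Suc (Suc k)) K"
    and centroid: "centroid (Suc (Suc k)) K = origin (Suc (Suc k))"
    and u: "u \<in> unit_sphere (Suc (Suc k))" and b: "hyperplane_basis (Suc (Suc k)) u b"
    and w: "w \<in> unit_sphere (Suc k)" and d: "hyperplane_basis (Suc k) w d"
begin

abbreviation "n \<equiv> Suc (Suc k)"

text \<open>
  The point with the coordinates \<open>fst p\<close> along \<open>u\<close> and \<open>snd p\<close> along the vector with the coordinates \<open>w\<close>,
  and \<open>y\<close> along the remaining directions.
\<close>
definition slice_point :: "real \<times> real \<Rightarrow> point \<Rightarrow> point" where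
  "slice_point p y = hyperplane_point (Suc k) u b (fst p) (hyperplane_point k w d (snd p) y)"

definition slice :: "real \<times> real \<Rightarrow> point set" where
  "slice p = {y \<in> points k. slice_point p y \<in> K}"

definition slice_volume :: "real \<times> real \<Rightarrow> real" where
  "slice_volume p = measure (lebesgue_on_points k) (slice p)"

lemma K_points: "K \<subseteq> points n" and K_compact: "compact K"
  using body compact_points by (auto simp: convex_body_def convex_set_def)

lemma K_sets [measurable]: "K \<in> sets (lebesgue_on_points n)"
  using K_points K_compact by (intro closed_in_sets compact_imp_closed)

lemma slice_point_measurable [measurable]:
  "(\<lambda>z. slice_point (fst z) (snd z)) \<in> measurable (borel \<Otimes>\<^sub>M lebesgue_on_points k) (lebesgue_on_points n)"
proof -
  have 1: "(\<lambda>z. (snd (fst z), snd z)) \<in> measurable (borel \<Otimes>\<^sub>M lebesgue_on_points k) (borel \<Otimes>\<^sub>M lebesgue_on_points k)"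
    by (intro measurable_Pair measurable_compose[OF measurable_fst] borel_measurable_continuous_onI continuous_intros measurable_snd)
  have 2: "(\<lambda>z. hyperplane_point k w d (snd (fst z)) (snd z)) \<in> measurable (borel \<Otimes>\<^sub>M lebesgue_on_points k) (lebesgue_on_points (Suc k))"
    using measurable_compose[OF 1 hyperplane_point_measurable] by simp
  have 3: "(\<lambda>z. (fst (fst z), hyperplane_point k w d (snd (fst z)) (snd z)))
      \<in> measurable (borel \<Otimes>\<^sub>M lebesgue_on_points k) (borel \<Otimes>\<^sub>M lebesgue_on_points (Suc k))"
    by (intro measurable_Pair 2 measurable_compose[OF measurable_fst] borel_measurable_continuous_onI continuous_intros)
  show ?thesis using measurable_compose[OF 3 hyperplane_point_measurable] by (simp add: slice_point_def)
qed

lemma slice_point_section [measurable]: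
  "slice_point p \<in> measurable (lebesgue_on_points k) (lebesgue_on_points n)"
proof -
  have "(\<lambda>y. (p, y)) \<in> measurable (lebesgue_on_points k) (borel \<Otimes>\<^sub>M lebesgue_on_points k)"
    by (intro measurable_Pair measurable_ident_sets measurable_const) auto
  from measurable_compose[OF this slice_point_measurable] show ?thesis by simp
qed

lemma slice_sets [measurable]: "slice p \<in> sets (lebesgue_on_points k)"
proof -
  have "slice p = slice_point p -` K \<inter> space (lebesgue_on_points k)" by (auto simp: slice_def)
  then show ?thesis using measurable_sets[OF slice_point_section K_sets] by simp
qed

lemma slice_point_norm: "inner_prod n (slice_point p y) (slice_point p y) = (fst p)\<^sup>2 + (snd p)\<^sup>2 + inner_prod k y y"
  unfolding slice_point_def by (simp add: inner_prod_hyperplane_coordinates(3)[OF u b] inner_prod_hyperplane_coordinates(3)[OF w d])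

text \<open>
  One bound serves for all slices, because the frame is orthonormal.
\<close>
lemma slices_bounded: "\<exists>R\<ge>0. \<forall>p y. y \<in> slice p \<longrightarrow> norm p \<le> R \<and> y \<in> cube k R"
proof -
  obtain R where R: "0 \<le> R" "\<And>x. x \<in> K \<Longrightarrow> inner_prod n x x \<le> R\<^sup>2" using compact_norm_bound[OF K_compact] by blast
  have "norm p \<le> R \<and> y \<in> cube k R" if y: "y \<in> slice p" for p y
  proof
    have sum: "(fst p)\<^sup>2 + (snd p)\<^sup>2 + inner_prod k y y \<le> R\<^sup>2"
      using R(2)[of "slice_point p y"] y unfolding slice_point_norm by (simp add: slice_def)
    have "0 \<le> inner_prod k y y" unfolding inner_prod_def by (intro sum_nonneg) simp
    then have "(norm p)\<^sup>2 \<le> R\<^sup>2" using sum by (simp add: norm_prod_def)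
    then show "norm p \<le> R" using R(1) by (rule power2_le_imp_le)
    have "inner_prod k y y \<le> R\<^sup>2" using sum by (smt (verit) zero_le_power2)
    then show "y \<in> cube k R" using y R(1) by (intro in_cube) (auto simp: slice_def)
  qed
  then show ?thesis using R(1) by blast
qed

lemma slice_finite: "emeasure (lebesgue_on_points k) (slice p) \<noteq> \<infinity>"
proof -
  obtain R where "\<And>y. y \<in> slice p \<Longrightarrow> y \<in> cube k R" using slices_bounded by blast
  then have "emeasure (lebesgue_on_points k) (slice p) \<le> emeasure (lebesgue_on_points k) (cube k R)"
    by (intro emeasure_mono cube_measure) auto
  then show ?thesis using cube_measure(2)[of k R] by (auto simp: top_unique)
qed

lemma emeasure_slice: "emeasure (lebesgue_on_points k) (slice p) = ennreal (slice_volume p)"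
  unfolding slice_volume_def using slice_finite by (simp add: emeasure_eq_ennreal_measure)

lemma slice_volume_measurable [measurable]: "slice_volume \<in> borel_measurable borel"
proof -
  interpret sigma_finite_measure "lebesgue_on_points k" by (rule sigma_finite_lebesgue_on_points)
  have "(\<lambda>z. indicator K (slice_point (fst z) (snd z)) :: ennreal) \<in> borel_measurable (borel \<Otimes>\<^sub>M lebesgue_on_points k)"
    by measurable
  then have "(\<lambda>p. \<integral>\<^sup>+y. indicator K (slice_point p y) \<partial>lebesgue_on_points k) \<in> borel_measurable borel"
    by (intro borel_measurable_nn_integral) (simp add: case_prod_beta')
  then have "(\<lambda>p. enn2real (\<integral>\<^sup>+y. indicator K (slice_point p y) \<partial>lebesgue_on_points k)) \<in> borel_measurable borel"
    by measurable
  moreover have "(\<integral>\<^sup>+y. indicator K (slice_point p y) \<partial>lebesgue_on_points k) = emeasure (lebesgue_on_points k) (slice p)" for p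
  proof -
    have "(\<integral>\<^sup>+y. indicator K (slice_point p y) \<partial>lebesgue_on_points k) = (\<integral>\<^sup>+y. indicator (slice p) y \<partial>lebesgue_on_points k)"
      by (rule nn_integral_cong) (auto simp: slice_def indicator_def)
    then show ?thesis by simp
  qed
  ultimately show ?thesis by (simp add: slice_volume_def[abs_def] measure_def)
qed

lemma slice_point_midpoint:
  "slice_point (midpoint p q) (\<lambda>i\<in>{..<k}. (x i + y i) / 2)
    = (\<lambda>i\<in>{..<n}. 1/2 * slice_point p x i + 1/2 * slice_point q y i)"
proof -
  have mid: "hyperplane_point m u b ((s + s') / 2) (\<lambda>i\<in>{..<m}. (t i + t' i) / 2)
      = (\<lambda>i\<in>{..<Suc m}. (hyperplane_point m u b s t i + hyperplane_point m u b s' t' i) / 2)"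
    for m u b s s' t t'
  proof -
    have "(\<Sum>j<m. (\<lambda>i\<in>{..<m}. (t i + t' i) / 2) j * b j i) = ((\<Sum>j<m. t j * b j i) + (\<Sum>j<m. t' j * b j i)) / 2" for i
      by (simp add: sum.distrib[symmetric] sum_divide_distrib distrib_right add_divide_distrib)
    then show ?thesis unfolding hyperplane_point_def
      by (intro restrict_ext) (simp add: field_simps)
  qed
  have "midpoint p q = ((fst p + fst q) / 2, (snd p + snd q) / 2)"
    by (simp add: midpoint_def prod_eq_iff)
  then show ?thesis unfolding slice_point_def
    by (simp add: mid field_simps cong: restrict_cong)
qed

text \<open>
  Convexity of the body says that the midpoint of two slices lies in the slice at the midpoint.
\<close>
lemma slice_volume_log_concave: "slice_volume p * slice_volume q \<le> (slice_volume (midpoint p q))\<^sup>2"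
proof -
  let ?I = "\<lambda>p. indicator (slice p) :: point \<Rightarrow> ennreal"
  have "(\<integral>\<^sup>+x. ?I p x \<partial>PiM {..<k} (\<lambda>_. lborel)) * (\<integral>\<^sup>+x. ?I q x \<partial>PiM {..<k} (\<lambda>_. lborel))
      \<le> (\<integral>\<^sup>+x. ?I (midpoint p q) x \<partial>PiM {..<k} (\<lambda>_. lborel))\<^sup>2"
  proof (rule prekopa_leindler)
    fix x y :: point assume xy: "x \<in> {..<k} \<rightarrow>\<^sub>E UNIV" "y \<in> {..<k} \<rightarrow>\<^sub>E UNIV"
    have "(\<lambda>i\<in>{..<k}. (x i + y i) / 2) \<in> slice (midpoint p q)" if "x \<in> slice p" "y \<in> slice q"
    proof -
      have "\<forall>x\<in>K. \<forall>y\<in>K. \<forall>s\<ge>0. \<forall>t\<ge>0. s + t = 1 \<longrightarrow> (\<lambda>i\<in>{..<n}. s * x i + t * y i) \<in> K"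
        using body by (simp add: convex_body_def convex_set_def)
      moreover have "slice_point p x \<in> K" "slice_point q y \<in> K" using that by (auto simp: slice_def)
      moreover have "(0::real) \<le> 1/2" "1/2 + 1/2 = (1::real)" by auto
      ultimately have "(\<lambda>i\<in>{..<n}. 1/2 * slice_point p x i + 1/2 * slice_point q y i) \<in> K" by blast
      then show ?thesis unfolding slice_def slice_point_midpoint[symmetric] by (simp add: points_def)
    qed
    then show "?I p x * ?I q y \<le> (?I (midpoint p q) (\<lambda>i\<in>{..<k}. (x i + y i) / 2))\<^sup>2"
      by (auto simp: indicator_def)
  qed (auto intro!: borel_measurable_indicator simp: slice_sets[unfolded lebesgue_on_points_def])
  then have "ennreal (slice_volume p) * ennreal (slice_volume q) \<le> (ennreal (slice_volume (midpoint p q)))\<^sup>2"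
    using slice_sets by (simp add: emeasure_slice flip: lebesgue_on_points_def)
  moreover have "0 \<le> slice_volume p" for p by (simp add: slice_volume_def)
  ultimately show ?thesis by (simp add: ennreal_power flip: ennreal_mult)
qed

lemma slice_point_continuous: "continuous_on UNIV (\<lambda>p. slice_point p y)"
proof (rule continuous_on_coordinatewise_then_product)
  have h: "continuous_on UNIV (\<lambda>p::real\<times>real. hyperplane_point m u b (f p) (t p) i)"
    if "continuous_on UNIV f" "\<And>j. continuous_on UNIV (\<lambda>p. t p j)" for m u b i f t
    unfolding hyperplane_point_def using that by (cases "i < Suc m") (auto intro!: continuous_intros)
  show "continuous_on UNIV (\<lambda>p. slice_point p y i)" for i
    unfolding slice_point_def by (intro h) (auto intro!: continuous_intros)
qed

text \<open>
  Upper semicontinuity. A point that lies in the slices at infinitely many members of a convergent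
  sequence lies in the slice at the limit, because the body is closed; continuity of the measure from
  above turns this inclusion into an inequality of volumes.
\<close>
lemma slice_volume_closed_superlevel: "closed {p. c \<le> slice_volume p}"
  unfolding closed_sequential_limits
proof (intro allI impI)
  fix P p assume "(\<forall>j. P j \<in> {p. c \<le> slice_volume p}) \<and> P \<longlonglongrightarrow> p"
  then have c: "\<And>j. c \<le> slice_volume (P j)" and lim: "P \<longlonglongrightarrow> p" by auto
  let ?M = "lebesgue_on_points k"
  obtain R where R: "\<And>p y. y \<in> slice p \<Longrightarrow> y \<in> cube k R" using slices_bounded by blast
  define B where "B i = (\<Union>j\<in>{i..}. slice (P j))" for i
  have B: "range B \<subseteq> sets ?M" unfolding B_def by (auto intro!: sets.countable_UN'' slice_sets)
  have fin: "emeasure ?M (B i) \<noteq> \<infinity>" for i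
  proof -
    have "emeasure ?M (B i) \<le> emeasure ?M (cube k R)"
      using R unfolding B_def by (intro emeasure_mono cube_measure) blast
    then show ?thesis using cube_measure(2)[of k R] by (auto simp: top_unique)
  qed
  have "decseq B" by (force simp: decseq_def B_def)
  then have "(\<lambda>i. measure ?M (B i)) \<longlonglongrightarrow> measure ?M (\<Inter>i. B i)" using Lim_measure_decseq[OF B _ fin] by blast
  moreover have "c \<le> measure ?M (B i)" for i
  proof -
    have "measure ?M (slice (P i)) \<le> measure ?M (B i)"
      using B fin[of i] by (intro measure_mono_fmeasurable) (auto simp: B_def fmeasurable_def less_top slice_sets)
    then show ?thesis using c[of i] by (simp add: slice_volume_def)
  qed
  ultimately have "c \<le> measure ?M (\<Inter>i. B i)" by (intro LIMSEQ_le_const) auto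
  also have "\<dots> \<le> measure ?M (slice p)"
  proof (rule measure_mono_fmeasurable)
    show "(\<Inter>i. B i) \<in> sets ?M" using B by blast
    show "slice p \<in> fmeasurable ?M" using slice_finite by (auto simp: fmeasurable_def less_top slice_sets)
    show "(\<Inter>i. B i) \<subseteq> slice p"
    proof
      fix y assume y: "y \<in> (\<Inter>i. B i)"
      then have yk: "y \<in> points k" by (auto simp: B_def slice_def)
      have "slice_point p y \<in> K"
      proof (rule ccontr)
        assume out: "slice_point p y \<notin> K"
        have "open ((\<lambda>p. slice_point p y) -` (- K))"
          using slice_point_continuous[of y] K_compact
          by (intro open_vimage) (auto intro: compact_imp_closed simp: open_Compl)
        then have "\<forall>\<^sub>F j in sequentially. P j \<in> (\<lambda>p. slice_point p y) -` (- K)"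
          using lim out by (intro topological_tendstoD) auto
        then obtain i where "\<And>j. i \<le> j \<Longrightarrow> slice_point (P j) y \<notin> K" by (auto simp: eventually_sequentially)
        moreover have "y \<in> B i" using y by blast
        ultimately show False by (auto simp: B_def slice_def)
      qed
      then show "y \<in> slice p" using yk by (simp add: slice_def)
    qed
  qed
  finally show "p \<in> {p. c \<le> slice_volume p}" by (simp add: slice_volume_def)
qed


lemma nn_integral_slices:
  assumes f: "f \<in> borel_measurable (lebesgue_on_points n)"
  shows "(\<integral>\<^sup>+x. f x \<partial>lebesgue_on_points n) = (\<integral>\<^sup>+p. \<integral>\<^sup>+y. f (slice_point p y) \<partial>lebesgue_on_points k \<partial>lborel)"
proof -
  interpret sigma_finite_measure "lebesgue_on_points k" by (rule sigma_finite_lebesgue_on_points)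
  let ?G = "\<lambda>p. \<integral>\<^sup>+y. f (slice_point p y) \<partial>lebesgue_on_points k"
  have "(\<lambda>z. f (slice_point (fst z) (snd z))) \<in> borel_measurable (borel \<Otimes>\<^sub>M lebesgue_on_points k)"
    by (rule measurable_compose[OF slice_point_measurable f])
  then have G: "?G \<in> borel_measurable borel"
    by (intro borel_measurable_nn_integral) (simp add: case_prod_beta')
  have sect: "(\<lambda>\<tau>. f (hyperplane_point (Suc k) u b s \<tau>)) \<in> borel_measurable (lebesgue_on_points (Suc k))" for s
  proof -
    have "(\<lambda>\<tau>. (s, \<tau>)) \<in> measurable (lebesgue_on_points (Suc k)) (borel \<Otimes>\<^sub>M lebesgue_on_points (Suc k))"
      by (intro measurable_Pair measurable_ident_sets measurable_const) auto
    from measurable_compose[OF measurable_compose[OF this hyperplane_point_measurable] f] show ?thesis by simp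
  qed
  have "(\<integral>\<^sup>+x. f x \<partial>lebesgue_on_points n)
      = (\<integral>\<^sup>+s. \<integral>\<^sup>+\<tau>. f (hyperplane_point (Suc k) u b s \<tau>) \<partial>lebesgue_on_points (Suc k) \<partial>lborel)"
    by (rule nn_integral_hyperplane[OF u b f])
  also have "\<dots> = (\<integral>\<^sup>+s. \<integral>\<^sup>+t. ?G (s, t) \<partial>lborel \<partial>lborel)"
    unfolding nn_integral_hyperplane[OF w d sect] by (simp add: slice_point_def)
  also have "\<dots> = (\<integral>\<^sup>+p. ?G p \<partial>(lborel \<Otimes>\<^sub>M lborel))"
    by (rule lborel.nn_integral_fst) (simp add: G lborel_prod)
  finally show ?thesis by (simp add: lborel_prod)
qed

text \<open>
  The equality of measures transfers \<open>nn_integral_slices\<close> to signed integrands.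
\<close>
lemma distr_slice_point:
  "distr (lborel \<Otimes>\<^sub>M lebesgue_on_points k) (lebesgue_on_points n) (\<lambda>z. slice_point (fst z) (snd z)) = lebesgue_on_points n"
proof (rule measure_eqI)
  interpret sigma_finite_measure "lebesgue_on_points k" by (rule sigma_finite_lebesgue_on_points)
  let ?P = "lborel \<Otimes>\<^sub>M lebesgue_on_points k :: ((real \<times> real) \<times> point) measure" and ?T = "\<lambda>z. slice_point (fst z) (snd z)"
  have T: "?T \<in> measurable ?P (lebesgue_on_points n)" using slice_point_measurable by simp
  fix A assume "A \<in> sets (distr ?P (lebesgue_on_points n) ?T)"
  then have A: "A \<in> sets (lebesgue_on_points n)" by simp
  have ind: "(\<lambda>z. indicator A (?T z) :: ennreal) \<in> borel_measurable ?P"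
    by (rule measurable_compose[OF T borel_measurable_indicator[OF A]])
  have "emeasure (distr ?P (lebesgue_on_points n) ?T) A = (\<integral>\<^sup>+x. indicator A x \<partial>distr ?P (lebesgue_on_points n) ?T)"
    using A by simp
  also have "\<dots> = (\<integral>\<^sup>+z. indicator A (?T z) \<partial>?P)" using A by (subst nn_integral_distr[OF T]) auto
  also have "\<dots> = (\<integral>\<^sup>+p. \<integral>\<^sup>+y. indicator A (slice_point p y) \<partial>lebesgue_on_points k \<partial>lborel)"
    using nn_integral_fst[OF ind] by simp
  also have "\<dots> = (\<integral>\<^sup>+x. indicator A x \<partial>lebesgue_on_points n)"
    using A by (intro nn_integral_slices[symmetric]) simp
  finally show "emeasure (distr ?P (lebesgue_on_points n) ?T) A = emeasure (lebesgue_on_points n) A"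
    using A by simp
qed simp

lemma K_finite: "emeasure (lebesgue_on_points n) K \<noteq> \<infinity>"
proof -
  obtain R where "0 \<le> R" "\<And>x. x \<in> K \<Longrightarrow> inner_prod n x x \<le> R\<^sup>2" using compact_norm_bound[OF K_compact] by blast
  then have "K \<subseteq> cube n R" using K_points in_cube by blast
  then have "emeasure (lebesgue_on_points n) K \<le> emeasure (lebesgue_on_points n) (cube n R)"
    by (intro emeasure_mono cube_measure)
  then show ?thesis using cube_measure(2)[of n R] by (auto simp: top_unique)
qed

lemma K_positive: "0 < measure (lebesgue_on_points n) K"
proof -
  have "0 < emeasure (lebesgue_on_points n) K"
    using body K_sets by (intro interior_positive_measure) (simp_all add: convex_body_def)
  then show ?thesis using K_finite by (simp add: emeasure_eq_ennreal_measure)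
qed

lemma integrable_on_body:
  fixes \<Phi> :: "point \<Rightarrow> real"
  assumes [measurable]: "\<Phi> \<in> borel_measurable (lebesgue_on_points n)" and C: "\<And>x. x \<in> K \<Longrightarrow> \<bar>\<Phi> x\<bar> \<le> C"
  shows "integrable (lebesgue_on_points n) (\<lambda>x. indicator K x * \<Phi> x)"
proof (rule Bochner_Integration.integrable_bound)
  show "integrable (lebesgue_on_points n) (\<lambda>x. C * indicator K x)"
    using K_finite by (intro integrable_mult_right integrable_real_indicator K_sets) (simp add: less_top)
  show "AE x in lebesgue_on_points n. norm (indicator K x * \<Phi> x) \<le> norm (C * indicator K x)"
    using C by (intro AE_I2) (force simp: indicator_def)
qed measurable

lemma integral_slices:
  fixes \<Phi> :: "point \<Rightarrow> real"
  assumes \<Phi> [measurable]: "\<Phi> \<in> borel_measurable (lebesgue_on_points n)" and C: "\<And>x. x \<in> K \<Longrightarrow> \<bar>\<Phi> x\<bar> \<le> C"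
    and \<phi>: "\<And>p y. \<Phi> (slice_point p y) = \<phi> p"
  shows "(\<integral>p. \<phi> p * slice_volume p \<partial>lborel) = (\<integral>x. indicator K x * \<Phi> x \<partial>lebesgue_on_points n)"
proof -
  interpret sigma_finite_measure "lebesgue_on_points k" by (rule sigma_finite_lebesgue_on_points)
  interpret pair_sigma_finite "lborel :: (real \<times> real) measure" "lebesgue_on_points k" by standard
  let ?P = "lborel \<Otimes>\<^sub>M lebesgue_on_points k :: ((real \<times> real) \<times> point) measure" and ?T = "\<lambda>z. slice_point (fst z) (snd z)"
  let ?g = "\<lambda>x. indicator K x * \<Phi> x"
  have T: "?T \<in> measurable ?P (lebesgue_on_points n)" using slice_point_measurable by simp
  have g: "?g \<in> borel_measurable (lebesgue_on_points n)" by measurable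
  have "integrable (distr ?P (lebesgue_on_points n) ?T) ?g"
    unfolding distr_slice_point using \<Phi> C by (rule integrable_on_body)
  then have int: "integrable ?P (\<lambda>z. ?g (?T z))" by (subst (asm) integrable_distr_eq[OF T g])
  have "(\<integral>x. ?g x \<partial>lebesgue_on_points n) = (\<integral>x. ?g x \<partial>distr ?P (lebesgue_on_points n) ?T)"
    by (simp only: distr_slice_point)
  also have "\<dots> = (\<integral>z. ?g (?T z) \<partial>?P)" by (rule integral_distr[OF T g])
  also have "\<dots> = (\<integral>p. \<integral>y. ?g (slice_point p y) \<partial>lebesgue_on_points k \<partial>lborel)"
    using integral_fst'[OF int] by simp
  finally have total: "(\<integral>x. ?g x \<partial>lebesgue_on_points n)
      = (\<integral>p. \<integral>y. ?g (slice_point p y) \<partial>lebesgue_on_points k \<partial>lborel)" .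
  have "(\<integral>y. ?g (slice_point p y) \<partial>lebesgue_on_points k) = \<phi> p * slice_volume p" for p
  proof -
    have "(\<integral>y. ?g (slice_point p y) \<partial>lebesgue_on_points k) = (\<integral>y. \<phi> p * indicator (slice p) y \<partial>lebesgue_on_points k)"
      by (rule Bochner_Integration.integral_cong) (auto simp: slice_def indicator_def \<phi>)
    also have "\<dots> = \<phi> p * slice_volume p" by (simp add: slice_volume_def slice_def Collect_conj_eq Int_commute)
    finally show ?thesis .
  qed
  then show ?thesis unfolding total by simp
qed

lemma first_moment_zero:
  assumes "i < n" shows "(\<integral>x. indicator K x * x i \<partial>lebesgue_on_points n) = 0"
proof -
  have "centroid n K i = 0" using assms by (simp add: centroid origin_def)
  then have "1 / measure (lebesgue_on_points n) K * (LINT x:K|lebesgue_on_points n. x i) = 0"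
    using assms unfolding centroid_def by (simp del: times_divide_eq_left)
  then show ?thesis using K_positive by (simp add: set_lebesgue_integral_def)
qed

lemma linear_moment_zero: "(\<integral>x. indicator K x * inner_prod n x l \<partial>lebesgue_on_points n) = 0"
proof -
  obtain R where R: "0 \<le> R" "\<And>x. x \<in> K \<Longrightarrow> inner_prod n x x \<le> R\<^sup>2" using compact_norm_bound[OF K_compact] by blast
  then have cube: "K \<subseteq> cube n R" using K_points in_cube by blast
  have int: "integrable (lebesgue_on_points n) (\<lambda>x. indicator K x * x i)" if i: "i < n" for i
  proof (rule integrable_on_body)
    show "\<bar>x i\<bar> \<le> R" if "x \<in> K" for x
      using cube that i by (force simp: cube_def PiE_iff abs_le_iff)
  qed (use i in measurable)
  have "(\<integral>x. indicator K x * inner_prod n x l \<partial>lebesgue_on_points n)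
      = (\<integral>x. (\<Sum>i<n. (indicator K x * x i) * l i) \<partial>lebesgue_on_points n)"
    unfolding inner_prod_def by (simp only: sum_distrib_left mult.assoc)
  also have "\<dots> = (\<Sum>i<n. \<integral>x. (indicator K x * x i) * l i \<partial>lebesgue_on_points n)"
    by (rule Bochner_Integration.integral_sum) (simp add: int)
  also have "\<dots> = 0" by (intro sum.neutral) (simp add: first_moment_zero del: mult_eq_0_iff)
  finally show ?thesis .
qed

lemma slice_point_coordinates:
  "inner_prod n (slice_point p y) u = fst p"
  "inner_prod n (slice_point p y) (hyperplane_point (Suc k) u b 0 w) = snd p"
proof -
  show "inner_prod n (slice_point p y) u = fst p"
    unfolding slice_point_def by (rule inner_prod_hyperplane_coordinates(1)[OF u b])
  let ?\<tau> = "hyperplane_point k w d (snd p) y"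
  have "inner_prod n (slice_point p y) (hyperplane_point (Suc k) u b 0 w)
      = (\<Sum>j<Suc k. w j * inner_prod n (b j) (slice_point p y))"
    by (subst inner_prod_commute) (simp add: inner_prod_hyperplane_point del: sum.lessThan_Suc)
  also have "\<dots> = (\<Sum>j<Suc k. w j * ?\<tau> j)"
    unfolding slice_point_def
    by (intro sum.cong refl) (simp add: inner_prod_commute[of _ "b _"] inner_prod_hyperplane_coordinates(2)[OF u b])
  also have "\<dots> = inner_prod (Suc k) ?\<tau> w" by (simp add: inner_prod_def mult.commute del: sum.lessThan_Suc)
  also have "\<dots> = snd p" by (rule inner_prod_hyperplane_coordinates(1)[OF w d])
  finally show "inner_prod n (slice_point p y) (hyperplane_point (Suc k) u b 0 w) = snd p" .
qed

lemma inner_prod_measurable [measurable]: "(\<lambda>x. inner_prod m x l) \<in> borel_measurable (lebesgue_on_points m)"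
  unfolding inner_prod_def by (intro borel_measurable_sum borel_measurable_times measurable_coordinate borel_measurable_const) simp

sublocale centred_log_concave slice_volume
proof
  show "0 \<le> slice_volume p" for p by (simp add: slice_volume_def)
  show "slice_volume \<in> borel_measurable borel" by (rule slice_volume_measurable)
  show "slice_volume p * slice_volume q \<le> (slice_volume (midpoint p q))\<^sup>2" for p q by (rule slice_volume_log_concave)
  show "closed {p. c \<le> slice_volume p}" for c by (rule slice_volume_closed_superlevel)
  obtain R where R: "\<And>p y. y \<in> slice p \<Longrightarrow> norm p \<le> R \<and> y \<in> cube k R" using slices_bounded by blast
  have "slice_volume p \<le> measure (lebesgue_on_points k) (cube k R)" for p
    unfolding slice_volume_def
  proof (intro measure_mono_fmeasurable slice_sets)
    show "slice p \<subseteq> cube k R" using R by blast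
    show "cube k R \<in> fmeasurable (lebesgue_on_points k)"
      using cube_measure[of k R] by (simp add: fmeasurable_def less_top)
  qed
  then show "\<exists>B. \<forall>p. slice_volume p \<le> B" by blast
  have "norm p \<le> R" if "slice_volume p \<noteq> 0" for p
  proof -
    have "slice p \<noteq> {}" using that by (auto simp: slice_volume_def)
    then show ?thesis using R by blast
  qed
  then show "bounded {p. slice_volume p \<noteq> 0}" unfolding bounded_iff by blast
  have "(\<integral>p. 1 * slice_volume p \<partial>lborel) = (\<integral>x. indicator K x * 1 \<partial>lebesgue_on_points n)"
    by (rule integral_slices[where C = 1]) auto
  then show "0 < (\<integral>p. slice_volume p \<partial>lborel)"
    using K_positive K_points by (simp add: Int_absorb2)
  fix a :: "real \<times> real"
  let ?l = "\<lambda>i. fst a * u i + snd a * hyperplane_point (Suc k) u b 0 w i"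
  have l: "inner_prod n x ?l = fst a * inner_prod n x u + snd a * inner_prod n x (hyperplane_point (Suc k) u b 0 w)" for x
    unfolding inner_prod_def sum_distrib_left sum.distrib[symmetric]
    by (intro sum.cong refl) (simp add: algebra_simps)
  have "\<exists>C. \<forall>x\<in>K. \<bar>inner_prod n x ?l\<bar> \<le> C"
  proof -
    have "continuous_on K (\<lambda>x. inner_prod n x ?l)" unfolding inner_prod_def
      by (intro continuous_intros continuous_on_subset[OF continuous_on_product_coordinates]) auto
    then have "bounded ((\<lambda>x. inner_prod n x ?l) ` K)"
      using K_compact by (intro compact_imp_bounded compact_continuous_image)
    then show ?thesis by (auto simp: bounded_real)
  qed
  then obtain C where "\<And>x. x \<in> K \<Longrightarrow> \<bar>inner_prod n x ?l\<bar> \<le> C" by blast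
  then have "(\<integral>p. (a \<bullet> p) * slice_volume p \<partial>lborel) = (\<integral>x. indicator K x * inner_prod n x ?l \<partial>lebesgue_on_points n)"
  proof (intro integral_slices inner_prod_measurable)
    fix p y
    have "a \<bullet> p = fst a * fst p + snd a * snd p" by (cases a, cases p) simp
    then show "inner_prod n (slice_point p y) ?l = a \<bullet> p" unfolding l slice_point_coordinates by simp
  qed
  then show "(\<integral>p. (a \<bullet> p) * slice_volume p \<partial>lborel) = 0" by (simp only: linear_moment_zero)
qed

text \<open>
  Slicing the hyperplane orthogonal to \<open>u\<close> once more, in the direction \<open>w\<close>, shows that its part above \<open>S\<close>
  is measured by the values of the planar function on the axis.
\<close>
lemma measure_section:
  assumes S [measurable]: "S \<in> sets borel"
  shows "measure (lebesgue_on_points (Suc k))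
      {\<tau> \<in> points (Suc k). hyperplane_point (Suc k) u b 0 \<tau> \<in> K \<and> inner_prod (Suc k) \<tau> w \<in> S}
    = (\<integral>t. indicator S t * slice_volume (t *\<^sub>R (0, 1)) \<partial>lborel)"
proof -
  let ?E = "{\<tau> \<in> points (Suc k). hyperplane_point (Suc k) u b 0 \<tau> \<in> K \<and> inner_prod (Suc k) \<tau> w \<in> S}"
  have "(\<lambda>\<tau>. (0, \<tau>)) \<in> measurable (lebesgue_on_points (Suc k)) (borel \<Otimes>\<^sub>M lebesgue_on_points (Suc k))"
    by (intro measurable_Pair measurable_ident_sets measurable_const) auto
  from measurable_compose[OF this hyperplane_point_measurable]
  have [measurable]: "hyperplane_point (Suc k) u b 0 \<in> measurable (lebesgue_on_points (Suc k)) (lebesgue_on_points n)"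
    by simp
  have "{\<tau> \<in> space (lebesgue_on_points (Suc k)). hyperplane_point (Suc k) u b 0 \<tau> \<in> K \<and> inner_prod (Suc k) \<tau> w \<in> S}
      \<in> sets (lebesgue_on_points (Suc k))" by measurable
  then have E: "?E \<in> sets (lebesgue_on_points (Suc k))" by simp
  have "emeasure (lebesgue_on_points (Suc k)) ?E = (\<integral>\<^sup>+\<tau>. indicator ?E \<tau> \<partial>lebesgue_on_points (Suc k))"
    using E by simp
  also have "\<dots> = (\<integral>\<^sup>+t. \<integral>\<^sup>+y. indicator ?E (hyperplane_point k w d t y) \<partial>lebesgue_on_points k \<partial>lborel)"
    by (rule nn_integral_hyperplane[OF w d]) (use E in simp)
  also have "\<dots> = (\<integral>\<^sup>+t. ennreal (indicator S t * slice_volume (t *\<^sub>R (0, 1))) \<partial>lborel)"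
  proof (rule nn_integral_cong)
    fix t :: real
    have "(\<integral>\<^sup>+y. indicator ?E (hyperplane_point k w d t y) \<partial>lebesgue_on_points k)
        = (\<integral>\<^sup>+y. indicator S t * indicator (slice (0, t)) y \<partial>lebesgue_on_points k)"
      by (rule nn_integral_cong)
         (auto simp add: indicator_def hyperplane_point_in_points inner_prod_hyperplane_coordinates(1)[OF w d] slice_def slice_point_def)
    also have "\<dots> = indicator S t * ennreal (slice_volume (0, t))"
      using slice_sets by (simp add: nn_integral_cmult emeasure_slice)
    also have "\<dots> = ennreal (indicator S t * slice_volume (t *\<^sub>R (0, 1)))" by (simp add: indicator_def)
    finally show "(\<integral>\<^sup>+y. indicator ?E (hyperplane_point k w d t y) \<partial>lebesgue_on_points k)
        = ennreal (indicator S t * slice_volume (t *\<^sub>R (0, 1)))" .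
  qed
  finally have "measure (lebesgue_on_points (Suc k)) ?E = enn2real (\<integral>\<^sup>+t. ennreal (indicator S t * slice_volume (t *\<^sub>R (0, 1))) \<partial>lborel)"
    by (simp add: measure_def)
  also have "\<dots> = (\<integral>t. indicator S t * slice_volume (t *\<^sub>R (0, 1)) \<partial>lborel)"
    by (rule integral_eq_nn_integral[symmetric]) (auto simp: nonneg)
  finally show ?thesis .
qed

end


section \<open>The two halves of a central section\<close>

text \<open>
  On the hyperplane orthogonal to \<open>u\<close> only the projection of \<open>v\<close> matters. It is a positive
  multiple \<open>\<beta>\<close> of a unit vector, whose coordinates in the basis \<open>b\<close> are \<open>w\<close>, so both halves of the section
  are half-axis integrals to which \<open>ray_integrals\<close> applies.
\<close>
theorem section_halves_comparable:
  assumes K: "convex_body (Suc (Suc k)) K" "centroid (Suc (Suc k)) K = origin (Suc (Suc k))"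
    and u: "u \<in> unit_sphere (Suc (Suc k))"
    and v: "v \<in> unit_sphere (Suc (Suc k))" "v \<noteq> u" "v \<noteq> neg (Suc (Suc k)) u"
  defines "V S \<equiv> hyperplane_volume (Suc (Suc k)) u {x \<in> K. inner_prod (Suc (Suc k)) x u = 0 \<and> inner_prod (Suc (Suc k)) x v \<in> S}"
  shows "0 < V {0..}" "0 < V {..0}" "V {0..} \<le> 2^45 * V {..0}" "V {..0} \<le> 2^45 * V {0..}"
proof -
  let ?n = "Suc (Suc k)"
  define b where "b = (SOME b. hyperplane_basis ?n u b)"
  have b: "hyperplane_basis ?n u b"
    unfolding b_def by (rule someI_ex[OF hyperplane_basis_exists[OF u]])
  define \<beta> where "\<beta> = sqrt (\<Sum>j<Suc k. (inner_prod ?n (b j) v)\<^sup>2)"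
  define w where "w = (\<lambda>j\<in>{..<Suc k}. inner_prod ?n (b j) v / \<beta>)"
  have \<beta>: "0 < \<beta>"
  proof -
    obtain j where j: "j < Suc k" "inner_prod ?n (b j) v \<noteq> 0"
      using hyperplane_coordinate_nonzero[OF u b v] by blast
    then have "0 < (\<Sum>j<Suc k. (inner_prod ?n (b j) v)\<^sup>2)"
      by (intro sum_pos2[of _ j]) auto
    then show ?thesis by (simp add: \<beta>_def)
  qed
  have w: "w \<in> unit_sphere (Suc k)"
  proof -
    have "inner_prod (Suc k) w w = (\<Sum>j<Suc k. (inner_prod ?n (b j) v)\<^sup>2 / \<beta>\<^sup>2)"
      unfolding inner_prod_def[of "Suc k"] by (intro sum.cong refl) (simp add: w_def power2_eq_square)
    also have "\<dots> = \<beta>\<^sup>2 / \<beta>\<^sup>2" by (simp add: \<beta>_def sum_nonneg flip: sum_divide_distrib del: sum.lessThan_Suc)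
    also have "\<dots> = 1" using \<beta> by simp
    finally show ?thesis by (simp add: unit_sphere_def w_def points_def)
  qed
  obtain d where d: "hyperplane_basis (Suc k) w d" using hyperplane_basis_exists[OF w] by blast
  interpret sliced_body k K u w b d by standard (use K u b w d in auto)
  have V: "V S = (\<integral>t. indicator S t * slice_volume (t *\<^sub>R (0, 1)) \<partial>lborel)"
    if S: "S \<in> sets borel" and scale: "\<And>t. \<beta> * t \<in> S \<longleftrightarrow> t \<in> S" for S
  proof -
    have point: "(\<lambda>i\<in>{..<?n}. \<Sum>j<?n - 1. \<tau> j * b j i) = hyperplane_point (Suc k) u b 0 \<tau>" for \<tau>
      by (simp add: hyperplane_point_def)
    have uv: "inner_prod ?n (hyperplane_point (Suc k) u b 0 \<tau>) v = \<beta> * inner_prod (Suc k) \<tau> w" for \<tau>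
    proof -
      have "inner_prod ?n (hyperplane_point (Suc k) u b 0 \<tau>) v = (\<Sum>j<Suc k. \<tau> j * inner_prod ?n (b j) v)"
        by (simp add: inner_prod_hyperplane_point del: sum.lessThan_Suc)
      also have "\<dots> = (\<Sum>j<Suc k. \<beta> * (\<tau> j * w j))"
        using \<beta> by (intro sum.cong refl) (simp add: w_def)
      finally show ?thesis unfolding inner_prod_def[of "Suc k"] by (simp only: sum_distrib_left)
    qed
    have "V S = measure (lebesgue_on_points (Suc k))
        {\<tau> \<in> points (Suc k). hyperplane_point (Suc k) u b 0 \<tau> \<in> K \<and> inner_prod (Suc k) \<tau> w \<in> S}"
      unfolding V_def hyperplane_volume_def Let_def b_def[symmetric] point mem_Collect_eq
        inner_prod_hyperplane_coordinates(1)[OF u b] uv scale by simp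
    then show ?thesis unfolding measure_section[OF S] .
  qed
  have pos: "V {0..} = (\<integral>t. indicator {0..} t * slice_volume (t *\<^sub>R (0, 1)) \<partial>lborel)"
    using \<beta> by (intro V) (auto simp: zero_le_mult_iff)
  have "V {..0} = (\<integral>t. indicator {..0} t * slice_volume (t *\<^sub>R (0, 1)) \<partial>lborel)"
    using \<beta> by (intro V) (auto simp: mult_le_0_iff)
  also have "\<dots> = (\<integral>t. indicator {..0} (- t) * slice_volume ((- t) *\<^sub>R (0, 1)) \<partial>lborel)"
    using lborel_integral_real_affine[of "- 1" "\<lambda>t. indicator {..0} t * slice_volume (t *\<^sub>R (0, 1))" 0] by simp
  also have "\<dots> = (\<integral>t. indicator {0..} t * slice_volume (t *\<^sub>R (- (0, 1))) \<partial>lborel)"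
    by (rule Bochner_Integration.integral_cong) (auto simp: indicator_def)
  finally have neg: "V {..0} = (\<integral>t. indicator {0..} t * slice_volume (t *\<^sub>R (- (0, 1))) \<partial>lborel)" .
  have e: "(0, 1) \<noteq> (0 :: real \<times> real)" "- (0, 1) \<noteq> (0 :: real \<times> real)" by (auto simp: zero_prod_def)
  show "0 < V {0..}" unfolding pos by (rule ray_integrals(1)[OF e(1)])
  show "0 < V {..0}" unfolding neg by (rule ray_integrals(1)[OF e(2)])
  show "V {..0} \<le> 2^45 * V {0..}" unfolding pos neg by (rule ray_integrals(2)[OF e(1)])
  show "V {0..} \<le> 2^45 * V {..0}" unfolding pos neg using ray_integrals(2)[OF e(2)] by (simp only: minus_minus)
qed

theorem corollary2:
  shows "\<exists>c::real. c > 0 \<and>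
    (\<forall>n::nat. \<forall>K u v. n \<ge> 2 \<longrightarrow> convex_body n K \<longrightarrow> centroid n K = origin n \<longrightarrow>
       u \<in> unit_sphere n \<longrightarrow> v \<in> unit_sphere n \<longrightarrow> v \<noteq> u \<longrightarrow> v \<noteq> neg n u \<longrightarrow>
       (let r = hyperplane_volume n u {x \<in> K. inner_prod n x u = 0 \<and> inner_prod n x v \<ge> 0} /
                hyperplane_volume n u {x \<in> K. inner_prod n x u = 0 \<and> inner_prod n x v \<le> 0}
        in 1 / c \<le> r \<and> r \<le> c))"
proof (intro exI[of _ "2^45"] conjI allI impI)
  fix n :: nat and K u v
  assume n: "n \<ge> 2" and K: "convex_body n K" "centroid n K = origin n"
    and uv: "u \<in> unit_sphere n" "v \<in> unit_sphere n" "v \<noteq> u" "v \<noteq> neg n u"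
  let ?a = "hyperplane_volume n u {x \<in> K. inner_prod n x u = 0 \<and> inner_prod n x v \<ge> 0}"
  let ?b = "hyperplane_volume n u {x \<in> K. inner_prod n x u = 0 \<and> inner_prod n x v \<le> 0}"
  obtain k where k: "n = Suc (Suc k)" using n by (metis add_2_eq_Suc le_Suc_ex)
  have ab: "0 < ?a" "0 < ?b" "?a \<le> 2^45 * ?b" "?b \<le> 2^45 * ?a"
    using section_halves_comparable[OF K[unfolded k] uv[unfolded k]]
    unfolding k atLeast_iff atMost_iff by this+
  then have "?a / ?b \<le> 2^45" by (simp only: pos_divide_le_eq)
  moreover have "1 / 2^45 \<le> ?a / ?b"
  proof -
    have "?b / (2^45 * ?b) \<le> ?a / ?b"
      using ab by (simp add: frac_le_eq divide_simps mult.commute)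
    then show ?thesis using ab(2) by simp
  qed
  ultimately show "let r = ?a / ?b in 1 / 2^45 \<le> r \<and> r \<le> 2^45" unfolding Let_def by blast
qed simp

end
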